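(* The binary problem with $2\times 2$ window is solvable in polynomial time: there is a polynomial-time algorithm which, given integers $m,n\ge 2$ and an integer matrix $S\in M_{m-1,n-1}$, either outputs a matrix $A\in M_{mn}$ with all entries in $\{0,1\}$ such that $\Sigma_{22}(A)=S$, or correctly reports that no such matrix exists. Moreover, in a typical RAM model this problem can be solved in $O(mn)$ time.
   Context: For positive integers $m,n$, $M_{mn}$ (also written $M_{m,n}$) is the set of all integer matrices with $m$ rows and $n$ columns; rows are numbered $0,\dots,m-1$ and columns $0,\dots,n-1$. For $1\le m'\le m$ and $1\le n'\le n$, the map $\Sigma_{m'n'}:M_{mn}\to M_{m-m'+1,\,n-n'+1}$ sends $A$ to the matrix of sums over all contiguous $m'\times n'$ windows: $(\Sigma_{m'n'}(A))_{ij}=\sum_{a=0}^{m'-1}\sum_{b=0}^{n'-1}A_{i+a,\,j+b}$. In particular $\Sigma_{22}(A)_{ij}=A_{ij}+A_{i+1,j}+A_{i,j+1}+A_{i+1,j+1}$. The binary problem with $2\times 2$ window is: given $S$, find some matrix $A$ with 0-1 entries satisfying $\Sigma_{22}(A)=S$, or establish that none exists. Polynomial time means polynomial in the length of the input. In the RAM model, memory access and elementary arithmetic operations and comparisons on integers take unit time. *)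

theory Defs
  imports
    "Jordan_Normal_Form.Matrix"
    "HOL-Computational_Algebra.Polynomial"
    "HOL-Library.Log_Nat"
begin

section \<open>Window sums and the binary problem\<close>

definition window_sum :: "nat \<Rightarrow> nat \<Rightarrow> int mat \<Rightarrow> int mat" where
  "window_sum p q A =
     mat (dim_row A + 1 - p) (dim_col A + 1 - q)
       (\<lambda>(i, j). \<Sum>a<p. \<Sum>b<q. A $$ (i + a, j + b))"

definition binary_solution_22 :: "nat \<Rightarrow> nat \<Rightarrow> int mat \<Rightarrow> int mat \<Rightarrow> bool" where
  "binary_solution_22 m n S A \<longleftrightarrow>
     A \<in> carrier_mat m n \<and> elements_mat A \<subseteq> {0, 1} \<and> window_sum 2 2 A = S"

definition entries :: "int mat \<Rightarrow> int list" where
  "entries A = concat (mat_to_list A)"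

definition encode_instance :: "nat \<Rightarrow> nat \<Rightarrow> int mat \<Rightarrow> int list" where
  "encode_instance m n S = int m # int n # entries S"

text \<open>The answer is either 1 followed by the entries of a solution in row-major order, or the
  single number 0, reporting that there is no solution.\<close>

definition correct_answer_22 :: "nat \<Rightarrow> nat \<Rightarrow> int mat \<Rightarrow> int list \<Rightarrow> bool" where
  "correct_answer_22 m n S ys \<longleftrightarrow>
     (\<exists>A. binary_solution_22 m n S A \<and> ys = 1 # entries A) \<or>
     (\<nexists>A. binary_solution_22 m n S A) \<and> ys = [0]"


section \<open>Random access machines\<close>

text \<open>The machine model is that of Cook and Reckhow (Time bounded random access machines,
  J. Comput. System Sci. 7, 1973): registers indexed by the natural numbers hold integers and are
  initially 0, a program is a finite list of instructions, and input and output are streams of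
  integers. Multiplication and division are not among the instructions, so the unit-cost
  measure cannot be abused by creating very long numbers in few steps; adding them would only
  make the existence of a program easier.

  In the comments below, \<open>X i\<close> is the content of register \<open>i\<close>.\<close>

datatype instr =
    Const nat int        (* X i := k *)
  | Add nat nat nat      (* X i := X j + X k *)
  | Sub nat nat nat      (* X i := X j - X k *)
  | Load nat nat         (* X i := X (X j) *)
  | Store nat nat        (* X (X i) := X j *)
  | Jump_Pos nat nat     (* go to instruction l if X j > 0 *)
  | Read nat             (* X i := next number of the input *)
  | Print nat            (* append X i to the output *)
  | Halt

text \<open>Length of an integer: a sign symbol followed by the binary digits of the absolute value.\<close>

definition int_length :: "int \<Rightarrow> nat" where
  "int_length x = 1 + floorlog 2 (nat \<bar>x\<bar>)"

definition input_length :: "int list \<Rightarrow> nat" where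
  "input_length xs = (\<Sum>x\<leftarrow>xs. int_length x)"

text \<open>A configuration consists of the program counter, the registers, the remaining input and the
  output produced so far.\<close>

type_synonym config = "nat \<times> (nat \<Rightarrow> int) \<times> int list \<times> int list"

text \<open>\<open>step P c w c'\<close>: one step leads from \<open>c\<close> to \<open>c'\<close>, and \<open>w\<close> is its logarithmic cost, that is,
  the total length of the operands and addresses accessed. There is no step
  if the program counter is out of range, on an indirect access to a negative address, and
  on reading from an exhausted input; such runs do not halt in the sense defined below.\<close>

inductive step :: "instr list \<Rightarrow> config \<Rightarrow> nat \<Rightarrow> config \<Rightarrow> bool" for P :: "instr list" where
  Const: "\<lbrakk>pc < length P; P ! pc = Const i k\<rbrakk> \<Longrightarrow>
    step P (pc, X, xs, ys) (int_length k) (pc + 1, X(i := k), xs, ys)"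
| Add: "\<lbrakk>pc < length P; P ! pc = Add i j k\<rbrakk> \<Longrightarrow>
    step P (pc, X, xs, ys) (int_length (X j) + int_length (X k))
      (pc + 1, X(i := X j + X k), xs, ys)"
| Sub: "\<lbrakk>pc < length P; P ! pc = Sub i j k\<rbrakk> \<Longrightarrow>
    step P (pc, X, xs, ys) (int_length (X j) + int_length (X k))
      (pc + 1, X(i := X j - X k), xs, ys)"
| Load: "\<lbrakk>pc < length P; P ! pc = Load i j; X j \<ge> 0\<rbrakk> \<Longrightarrow>
    step P (pc, X, xs, ys) (int_length (X j) + int_length (X (nat (X j))))
      (pc + 1, X(i := X (nat (X j))), xs, ys)"
| Store: "\<lbrakk>pc < length P; P ! pc = Store i j; X i \<ge> 0\<rbrakk> \<Longrightarrow>
    step P (pc, X, xs, ys) (int_length (X i) + int_length (X j))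
      (pc + 1, X(nat (X i) := X j), xs, ys)"
| Jump_Pos: "\<lbrakk>pc < length P; P ! pc = Jump_Pos l j\<rbrakk> \<Longrightarrow>
    step P (pc, X, xs, ys) (int_length (X j))
      (if X j > 0 then l else pc + 1, X, xs, ys)"
| Read: "\<lbrakk>pc < length P; P ! pc = Read i\<rbrakk> \<Longrightarrow>
    step P (pc, X, x # xs, ys) (int_length x) (pc + 1, X(i := x), xs, ys)"
| Print: "\<lbrakk>pc < length P; P ! pc = Print i\<rbrakk> \<Longrightarrow>
    step P (pc, X, xs, ys) (int_length (X i)) (pc + 1, X, xs, ys @ [X i])"

text \<open>\<open>exec P c t w ys\<close>: started in \<open>c\<close>, the program halts with output \<open>ys\<close> after \<open>t\<close> steps of total
  logarithmic cost \<open>w\<close>.\<close>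

inductive exec :: "instr list \<Rightarrow> config \<Rightarrow> nat \<Rightarrow> nat \<Rightarrow> int list \<Rightarrow> bool"
  for P :: "instr list" where
  halt: "\<lbrakk>pc < length P; P ! pc = Halt\<rbrakk> \<Longrightarrow> exec P (pc, X, xs, ys) 1 1 ys"
| step: "\<lbrakk>step P c w c'; exec P c' t w' ys\<rbrakk> \<Longrightarrow> exec P c (t + 1) (w + w') ys"

definition run :: "instr list \<Rightarrow> int list \<Rightarrow> nat \<Rightarrow> nat \<Rightarrow> int list \<Rightarrow> bool" where
  "run P xs t w ys \<longleftrightarrow> exec P (0, \<lambda>_. 0, xs, []) t w ys"

end

theory Submission
  imports Defs
begin

text \<open>
Complement the entries of \<open>A\<close> at the positions with \<open>i + j\<close> odd. The condition on the window sums then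
prescribes all mixed second differences of the new matrix, and complementing does not affect whether
entries are binary. A matrix with prescribed mixed second differences is determined up to adding
functions of the row and of the column. So the problem becomes: given an integer matrix \<open>C\<close>
(here \<open>potential\<close>), adjust its columns by numbers \<open>x j\<close> and its rows by numbers \<open>w i\<close> such that all
\<open>C i j + x j - w i\<close> are 0 or 1. Row 0 of \<open>C\<close> vanishes, so \<open>x\<close> may be taken binary
(\<open>binary_windows_22_iff\<close>).

Let \<open>X\<close> be the set of columns with \<open>x j = 1\<close>. Every row \<open>i\<close> demands that its set of low columns, those
where the row minimum is attained, is comparable with \<open>X\<close>, and the sizes of the two sets tell which
inclusion holds. Hence the only thing to be found is the number \<open>k = card X\<close>: it determines the row
adjustments, and for the columns one takes the smallest set that they force. The constraints on
\<open>k\<close> are lower bounds, possibly conditional on other lower bounds, and conditions that become weaker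
as \<open>k\<close> decreases. So the least \<open>k\<close> that satisfies the lower bounds gives a solution if there is
one (\<open>candidate_binary_if_solvable\<close>). Computing it takes a constant number of passes over the matrix, each
with constant work per entry, and no search.

The algorithm is written in a language with arrays and counting loops (\<open>solver\<close>). Weakest preconditions
establish its correctness (\<open>wp_solver\<close>), the time bound is read off the nesting of the loops
(\<open>time_bound_solver\<close>), and a verified compiler carries both over to the random access machine
(\<open>compile_correct\<close>). The same machine program serves for the two halves of the theorem: since a
step at most doubles the largest number, a run of \<open>t\<close> steps costs at most quadratically much in
\<open>t\<close> plus the input length (\<open>run_cost_le\<close>).
\<close>


section \<open>Reduction to adjusting rows and columns\<close>

definition windows_22 :: "nat \<Rightarrow> nat \<Rightarrow> (nat \<Rightarrow> nat \<Rightarrow> int) \<Rightarrow> (nat \<Rightarrow> nat \<Rightarrow> int) \<Rightarrow> bool" where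
  "windows_22 m n s A \<longleftrightarrow> (\<forall>i j. Suc i < m \<longrightarrow> Suc j < n \<longrightarrow>
     A i j + A (Suc i) j + A i (Suc j) + A (Suc i) (Suc j) = s i j)"

text \<open>Complementing the entries with \<open>i + j\<close> odd turns the four signs of a window sum into those of a
mixed second difference. The number of complemented entries in a window is always two, which is
where the constant 2 in \<open>mixed_diff\<close> comes from.\<close>

definition flip :: "nat \<Rightarrow> nat \<Rightarrow> int \<Rightarrow> int" where
  "flip i j a = (if even (i + j) then a else 1 - a)"

definition mixed_diff :: "(nat \<Rightarrow> nat \<Rightarrow> int) \<Rightarrow> nat \<Rightarrow> nat \<Rightarrow> int" where
  "mixed_diff s i j = (if even (i + j) then s i j - 2 else 2 - s i j)"

text \<open>The matrix with the prescribed mixed second differences whose row 0 and column 0 vanish.\<close>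

definition potential :: "(nat \<Rightarrow> nat \<Rightarrow> int) \<Rightarrow> nat \<Rightarrow> nat \<Rightarrow> int" where
  "potential s i j = (\<Sum>a<i. \<Sum>b<j. mixed_diff s a b)"

lemma flip_flip [simp]: "flip i j (flip i j a) = a"
  by (simp add: flip_def)

lemma flip_01 [simp]: "flip i j a \<in> {0, 1} \<longleftrightarrow> a \<in> {0, 1}"
  by (auto simp: flip_def)

lemma windows_22_flip:
  "windows_22 m n s (\<lambda>i j. flip i j (B i j)) \<longleftrightarrow> (\<forall>i j. Suc i < m \<longrightarrow> Suc j < n \<longrightarrow>
     B (Suc i) (Suc j) - B (Suc i) j - B i (Suc j) + B i j = mixed_diff s i j)"
proof -
  have "flip i j (B i j) + flip (Suc i) j (B (Suc i) j) + flip i (Suc j) (B i (Suc j)) +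
      flip (Suc i) (Suc j) (B (Suc i) (Suc j)) = s i j \<longleftrightarrow>
      B (Suc i) (Suc j) - B (Suc i) j - B i (Suc j) + B i j = mixed_diff s i j" for i j
    by (auto simp: flip_def mixed_diff_def)
  then show ?thesis
    by (simp add: windows_22_def)
qed

lemma potential_0 [simp]: "potential s 0 j = 0" "potential s i 0 = 0"
  by (simp_all add: potential_def)

lemma potential_Suc: "potential s (Suc i) j = potential s i j + (\<Sum>b<j. mixed_diff s i b)"
  by (simp add: potential_def)

text \<open>Two matrices with the same mixed second differences differ by a function of the row plus a
function of the column, because the row differences \<open>B (Suc i) j - B i j\<close> have prescribed
increments along the row.\<close>

lemma eq_potential_plus_borders:
  assumes "\<And>i j. Suc i < m \<Longrightarrow> Suc j < n \<Longrightarrow>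
      B (Suc i) (Suc j) - B (Suc i) j - B i (Suc j) + B i j = mixed_diff s i j"
    and "i < m" "j < n"
  shows "B i j = potential s i j + B 0 j + B i 0 - B 0 0"
  using assms(2)
proof (induction i)
  case 0
  then show ?case by simp
next
  case (Suc i)
  have "B (Suc i) j' - B i j' = (\<Sum>b<j'. mixed_diff s i b) + B (Suc i) 0 - B i 0" if "j' < n" for j'
    using that
  proof (induction j')
    case (Suc j')
    then show ?case
      using assms(1)[of i j'] \<open>Suc i < m\<close> by simp
  qed simp
  from this[OF assms(3)] Suc show ?case
    by (simp add: potential_Suc)
qed

lemma windows_22_potential:
  "windows_22 m n s (\<lambda>i j. flip i j (potential s i j + x j - w i))"
  unfolding windows_22_flip by (simp add: potential_Suc)

text \<open>Row 0 of the potential is 0, so row 0 of the complemented solution can itself serve as the column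
adjustment \<open>x\<close>. This is why \<open>x\<close> may be required to be binary, whereas \<open>w\<close> ranges over all integers.\<close>

lemma binary_windows_22_iff:
  assumes "0 < m" "0 < n"
  shows "(\<exists>A. (\<forall>i<m. \<forall>j<n. A i j \<in> {0, 1}) \<and> windows_22 m n s A) \<longleftrightarrow>
    (\<exists>x w. (\<forall>j<n. x j \<in> {0, 1}) \<and> (\<forall>i<m. \<forall>j<n. potential s i j + x j - w i \<in> {0, 1}))"
    (is "?L \<longleftrightarrow> ?R")
proof
  assume ?L
  then obtain A where A: "\<And>i j. i < m \<Longrightarrow> j < n \<Longrightarrow> A i j \<in> {0, 1}" "windows_22 m n s A"
    by blast
  define B where "B i j = flip i j (A i j)" for i j
  have "windows_22 m n s (\<lambda>i j. flip i j (B i j))"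
    using A(2) by (simp add: B_def)
  then have "B i j = potential s i j + B 0 j - (B 0 0 - B i 0)" if "i < m" "j < n" for i j
    using eq_potential_plus_borders[of m n B s i j] that by (simp add: windows_22_flip)
  moreover have B: "B i j \<in> {0, 1}" if "i < m" "j < n" for i j
    unfolding B_def flip_01 by (rule A(1)[OF that])
  ultimately show ?R
    using assms(1) by (intro exI[of _ "B 0"] exI[of _ "\<lambda>i. B 0 0 - B i 0"]) metis
next
  assume ?R
  then obtain x w where *: "\<And>i j. i < m \<Longrightarrow> j < n \<Longrightarrow> potential s i j + x j - w i \<in> {0, 1}"
    by blast
  show ?L
  proof (intro exI conjI allI impI)
    show "flip i j (potential s i j + x j - w i) \<in> {0, 1}" if "i < m" "j < n" for i j
      unfolding flip_01 by (rule *[OF that])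
  qed (rule windows_22_potential)
qed


section \<open>Closed thresholds\<close>

text \<open>It remains to decide, for an integer matrix \<open>C\<close>, whether adding a binary number to each column and
subtracting an integer from each row can make all entries binary. Let \<open>X\<close> be the set of columns that
are raised. If row \<open>i\<close> is lowered to one more than its minimum, then all columns where the minimum is
attained must lie in \<open>X\<close>; otherwise \<open>X\<close> must lie inside the set of these columns. Such a choice for
every row is a disjunction, but two comparable finite sets are compared by their sizes:
once \<open>k = card X\<close> is known, the rows with \<open>low_count i \<le> k\<close> are exactly those for which
the first alternative can be taken. So it suffices to search for the number \<open>k\<close>.\<close>

locale threshold =
  fixes m n :: nat and C :: "nat \<Rightarrow> nat \<Rightarrow> int"
  assumes pos: "0 < m" "0 < n"
begin

definition row_min :: "nat \<Rightarrow> int" where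
  "row_min i = Min (C i ` {..<n})"

definition low_count :: "nat \<Rightarrow> nat" where
  "low_count i = card {j. j < n \<and> C i j = row_min i}"

text \<open>The least \<open>k\<close> from which on column \<open>j\<close> has to be raised. The default \<open>n\<close> is harmless, since
\<open>card X = n\<close> means that every column is raised; it keeps all thresholds in the range up to \<open>n\<close>.\<close>

definition onset :: "nat \<Rightarrow> nat" where
  "onset j = Min (insert n {low_count i |i. i < m \<and> C i j = row_min i})"

text \<open>Raising only the columns with \<open>onset j \<le> k\<close>, an entry one above the row minimum that is raised, and
any entry further above it, must be compensated by lowering the row by one more. These
conditions bound \<open>k\<close> from below. The remaining conditions on \<open>k\<close> only become weaker
when \<open>k\<close> decreases, so only the least \<open>k\<close> meeting the lower bounds has to be examined.\<close>

definition closed_at :: "nat \<Rightarrow> bool" where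
  "closed_at k \<longleftrightarrow> (\<forall>i<m. \<forall>j<n.
     C i j = row_min i + 1 \<and> onset j \<le> k \<or> row_min i + 2 \<le> C i j \<longrightarrow> low_count i \<le> k)"

definition candidate :: "nat \<Rightarrow> nat \<Rightarrow> nat \<Rightarrow> int" where
  "candidate k i j = C i j + of_bool (onset j \<le> k) - (row_min i + of_bool (low_count i \<le> k))"

lemma row_min_le: "j < n \<Longrightarrow> row_min i \<le> C i j"
  unfolding row_min_def by (intro Min_le) auto

lemma row_min_attained: obtains j where "j < n" "C i j = row_min i"
proof -
  have "row_min i \<in> C i ` {..<n}"
    unfolding row_min_def using pos by (intro Min_in) auto
  then show thesis
    using that by auto
qed

lemma low_count_le: "low_count i \<le> n"
  unfolding low_count_def using card_mono[of "{..<n}" "{j. j < n \<and> C i j = row_min i}"] by auto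

lemma onset_le_iff: "onset j \<le> k \<longleftrightarrow> n \<le> k \<or> (\<exists>i<m. C i j = row_min i \<and> low_count i \<le> k)"
  unfolding onset_def by (subst Min_le_iff) auto

lemma closed_at_n: "closed_at n"
  unfolding closed_at_def using low_count_le by blast

text \<open>For a solution with \<open>k = card X\<close>, comparability of \<open>X\<close> with the low columns of each row shows that the
row adjustment may be replaced by the one that \<open>candidate\<close> uses, and that every column with
\<open>onset j \<le> card X\<close> is in \<open>X\<close>. Hence \<open>card X\<close> is closed, the least closed \<open>k\<close> is at most \<open>card X\<close>, and the
columns raised for \<open>k\<close> form a subset of \<open>X\<close>; this is enough to transfer the bounds on the entries.\<close>

lemma candidate_binary_if_solvable:
  assumes x: "\<And>j. j < n \<Longrightarrow> x j \<in> {0, 1}"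
    and xw: "\<And>i j. i < m \<Longrightarrow> j < n \<Longrightarrow> C i j + x j - w i \<in> {0, 1}"
    and k: "closed_at k" "\<And>k'. closed_at k' \<Longrightarrow> k \<le> k'"
    and ij: "i < m" "j < n"
  shows "candidate k i j \<in> {0, 1}"
proof -
  define X where "X = {j. j < n \<and> x j = 1}"
  define L where "L i = {j. j < n \<and> C i j = row_min i}" for i
  have fin: "finite X" "finite (L i)" for i
    by (simp_all add: X_def L_def)
  have x_cases: "x j = of_bool (j \<in> X)" if "j < n" for j
    using x[OF that] that by (auto simp: X_def)
  \<comment> \<open>In each row, the low columns and the raised columns are comparable.\<close>
  have w: "w i = row_min i + 1 \<and> L i \<subseteq> X \<or> w i \<le> row_min i \<and> X \<subseteq> L i" if i: "i < m" for i
  proof (cases "w i \<le> row_min i")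
    case True
    have "j \<in> L i" if "j \<in> X" for j
    proof -
      have "j < n" "x j = 1"
        using that by (auto simp: X_def)
      then show ?thesis
        using xw[OF i, of j] row_min_le[of j i] True by (auto simp: L_def)
    qed
    with True show ?thesis by blast
  next
    case False
    have "w i = row_min i + 1 \<and> x j = 1" if "j \<in> L i" for j
    proof -
      have "j < n" "C i j = row_min i"
        using that by (auto simp: L_def)
      then show ?thesis
        using xw[OF i, of j] x[of j] False by auto
    qed
    moreover obtain j where "j \<in> L i"
      using row_min_attained[of i] by (auto simp: L_def)
    ultimately show ?thesis
      by (auto simp: X_def L_def)
  qed
  \<comment> \<open>In the second alternative the sizes are equal, so both sets coincide and lowering the
      row by one more is possible, too.\<close>
  have up: "C i j + x j - (row_min i + 1) \<in> {0, 1} \<and> (C i j = row_min i \<longrightarrow> x j = 1)"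
    if "i < m" "j < n" "low_count i \<le> card X" for i j
    using w[OF that(1)]
  proof
    assume "w i = row_min i + 1 \<and> L i \<subseteq> X"
    then show ?thesis
      using xw[OF that(1,2)] that(2) by (auto simp: L_def X_def)
  next
    assume *: "w i \<le> row_min i \<and> X \<subseteq> L i"
    then have "X = L i"
      using that(3) card_seteq[OF fin(2)[of i], of X] by (simp add: low_count_def L_def)
    then show ?thesis
      using xw[OF that(1,2)] x_cases[OF that(2)] row_min_le[OF that(2), of i] that(2) *
      by (auto simp: L_def)
  qed
  have down: "C i j = row_min i \<or> C i j = row_min i + 1 \<and> x j = 0"
    if "i < m" "j < n" "card X < low_count i" for i j
  proof -
    have "\<not> L i \<subseteq> X"
      using that(3) card_mono[OF fin(1), of "L i"] by (auto simp: low_count_def L_def)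
    then have "w i \<le> row_min i" "X \<subseteq> L i"
      using w[OF that(1)] by blast+
    then show ?thesis
      using xw[OF that(1,2)] x_cases[OF that(2)] row_min_le[OF that(2), of i] that(2)
      by (cases "j \<in> X") (auto simp: L_def)
  qed
  have onset: "x j = 1" if "j < n" "onset j \<le> card X" for j
  proof (cases "n \<le> card X")
    case True
    then have "X = {..<n}"
      using card_seteq[of "{..<n}" X] by (auto simp: X_def)
    then show ?thesis
      using that(1) by (auto simp: X_def)
  next
    case False
    then show ?thesis
      using that up unfolding onset_le_iff by blast
  qed
  have "closed_at (card X)"
    unfolding closed_at_def
  proof (intro allI impI)
    fix i j
    assume "i < m" "j < n" and *: "C i j = row_min i + 1 \<and> onset j \<le> card X \<or> row_min i + 2 \<le> C i j"
    then show "low_count i \<le> card X"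
      using down[of i j] onset[of j] by (cases "low_count i \<le> card X") auto
  qed
  then have kX: "k \<le> card X"
    by (rule k(2))
  have onset_k: "onset j \<le> k \<Longrightarrow> x j = 1"
    using onset[OF ij(2)] kX by simp
  consider "C i j = row_min i" | "C i j = row_min i + 1" | "row_min i + 2 \<le> C i j"
    using row_min_le[OF ij(2), of i] by linarith
  then show ?thesis
  proof cases
    case 1
    then have "low_count i \<le> k \<Longrightarrow> onset j \<le> k"
      using ij(1) unfolding onset_le_iff by blast
    with 1 show ?thesis
      by (auto simp: candidate_def)
  next
    case 2
    then have "onset j \<le> k \<Longrightarrow> low_count i \<le> k"
      using k(1) ij unfolding closed_at_def by blast
    with 2 show ?thesis
      by (auto simp: candidate_def)
  next
    case 3
    then have c: "low_count i \<le> k"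
      using k(1) ij unfolding closed_at_def by blast
    then have "C i j + x j - (row_min i + 1) \<in> {0, 1}"
      using up[OF ij] kX by simp
    with 3 have "x j = 0" "C i j = row_min i + 2"
      using x[OF ij(2)] by auto
    with c onset_k show ?thesis
      by (auto simp: candidate_def)
  qed
qed

end

lemma binary_windows_22_iff_candidate:
  assumes "0 < m" "0 < n"
    and "threshold.closed_at m n (potential s) k"
    and "\<And>k'. threshold.closed_at m n (potential s) k' \<Longrightarrow> k \<le> k'"
  shows "(\<exists>A. (\<forall>i<m. \<forall>j<n. A i j \<in> {0, 1}) \<and> windows_22 m n s A) \<longleftrightarrow>
    (\<forall>i<m. \<forall>j<n. threshold.candidate m n (potential s) k i j \<in> {0, 1})"
    (is "?L \<longleftrightarrow> ?R")
proof -
  interpret threshold m n "potential s"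
    using assms by unfold_locales
  show ?thesis
    unfolding binary_windows_22_iff[OF assms(1,2)]
  proof
    assume "\<exists>x w. (\<forall>j<n. x j \<in> {0, 1}) \<and> (\<forall>i<m. \<forall>j<n. potential s i j + x j - w i \<in> {0, 1})"
    then show "\<forall>i<m. \<forall>j<n. candidate k i j \<in> {0, 1}"
      using candidate_binary_if_solvable[OF _ _ assms(3,4)] by blast
  next
    assume "\<forall>i<m. \<forall>j<n. candidate k i j \<in> {0, 1}"
    then show "\<exists>x w. (\<forall>j<n. x j \<in> {0, 1}) \<and> (\<forall>i<m. \<forall>j<n. potential s i j + x j - w i \<in> {0, 1})"
      by (intro exI[of _ "\<lambda>j. of_bool (onset j \<le> k)"] exI[of _ "\<lambda>i. row_min i + of_bool (low_count i \<le> k)"])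
        (auto simp: candidate_def)
  qed
qed

text \<open>Adjusting rows and columns never disturbs the window sums, so a binary candidate is a solution.\<close>

lemma windows_22_candidate: "windows_22 m n s (\<lambda>i j. flip i j (threshold.candidate m n (potential s) k i j))"
  if "0 < m" "0 < n"
proof -
  interpret threshold m n "potential s"
    using that by unfold_locales
  show ?thesis
    unfolding candidate_def by (rule windows_22_potential)
qed


section \<open>Logarithmic cost from step count\<close>

lemma int_length_le_Suc:
  assumes "\<bar>x\<bar> \<le> 2 ^ b"
  shows "int_length x \<le> b + 2"
proof -
  have "nat \<bar>x\<bar> \<le> 2 ^ b"
    using assms by (simp add: nat_le_iff)
  then have "nat \<bar>x\<bar> < 2 ^ Suc b"
    by (rule le_less_trans) simp
  then have "floorlog 2 (nat \<bar>x\<bar>) \<le> Suc b"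
    by (subst floorlog_le_iff) auto
  then show ?thesis
    by (simp add: int_length_def)
qed

lemma abs_le_two_pow_int_length: "\<bar>x\<bar> \<le> 2 ^ int_length x"
proof -
  have "nat \<bar>x\<bar> < 2 ^ floorlog 2 (nat \<bar>x\<bar>)"
    using floorlog_leD[of 2 "nat \<bar>x\<bar>" "floorlog 2 (nat \<bar>x\<bar>)"] by simp
  also have "\<dots> \<le> 2 ^ int_length x"
    by (simp add: int_length_def)
  finally have "int (nat \<bar>x\<bar>) < int (2 ^ int_length x)"
    by (simp only: of_nat_less_iff)
  then show ?thesis
    by simp
qed

lemma int_length_le_input_length: "x \<in> set xs \<Longrightarrow> int_length x \<le> input_length xs"
  unfolding input_length_def by (simp add: member_le_sum_list)

lemma length_le_input_length: "length xs \<le> input_length xs"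
  unfolding input_length_def int_length_def by (induction xs) auto

text \<open>With addition and subtraction as the only arithmetic, one step at most doubles the largest
absolute value. Lengths therefore grow by at most one per step, and a bound on the number of steps
alone already yields a polynomial bound on the logarithmic cost.\<close>

definition bounded_config :: "nat \<Rightarrow> config \<Rightarrow> bool" where
  "bounded_config b = (\<lambda>(pc, X, xs, ys). (\<forall>i. \<bar>X i\<bar> \<le> 2 ^ b) \<and> (\<forall>x\<in>set xs. \<bar>x\<bar> \<le> 2 ^ b))"

lemma step_bounded:
  assumes "step P c w c'" "bounded_config b c" "\<And>i k. Const i k \<in> set P \<Longrightarrow> \<bar>k\<bar> \<le> 2 ^ b"
  shows "w \<le> 2 * (b + 2) \<and> bounded_config (Suc b) c'"
proof -
  have grow: "\<bar>x\<bar> \<le> 2 * 2 ^ b" if "\<bar>x\<bar> \<le> 2 ^ b" for x :: int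
    using that by linarith
  have grow_add: "\<bar>x + y\<bar> \<le> 2 * 2 ^ b" and grow_diff: "\<bar>x - y\<bar> \<le> 2 * 2 ^ b"
    if "\<bar>x\<bar> \<le> 2 ^ b" "\<bar>y\<bar> \<le> 2 ^ b" for x y :: int
    using that by linarith+
  from assms show ?thesis
  proof (cases rule: step.cases)
    case (Const pc i k X xs ys)
    then have "\<bar>k\<bar> \<le> 2 ^ b"
      using assms(3) nth_mem by metis
    moreover from this have "int_length k \<le> b + 2"
      by (rule int_length_le_Suc)
    ultimately show ?thesis
      using Const assms(2) by (auto simp: bounded_config_def intro: grow grow_add grow_diff)
  next
    case (Add pc i j k X xs ys)
    then have "\<bar>X j\<bar> \<le> 2 ^ b" "\<bar>X k\<bar> \<le> 2 ^ b"
      using assms(2) by (auto simp: bounded_config_def)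
    moreover from this have "int_length (X j) \<le> b + 2" "int_length (X k) \<le> b + 2"
      by (simp_all only: int_length_le_Suc)
    ultimately show ?thesis
      using Add assms(2) by (auto simp: bounded_config_def intro: grow grow_add grow_diff)
  next
    case (Sub pc i j k X xs ys)
    then have "\<bar>X j\<bar> \<le> 2 ^ b" "\<bar>X k\<bar> \<le> 2 ^ b"
      using assms(2) by (auto simp: bounded_config_def)
    moreover from this have "int_length (X j) \<le> b + 2" "int_length (X k) \<le> b + 2"
      by (simp_all only: int_length_le_Suc)
    ultimately show ?thesis
      using Sub assms(2) by (auto simp: bounded_config_def intro: grow grow_add grow_diff)
  next
    case (Load pc i j X xs ys)
    have "\<bar>X j\<bar> \<le> 2 ^ b" "\<bar>X (nat (X j))\<bar> \<le> 2 ^ b"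
      using assms(2) unfolding Load(1) by (simp_all add: bounded_config_def)
    moreover from this have "int_length (X j) \<le> b + 2" "int_length (X (nat (X j))) \<le> b + 2"
      by (simp_all only: int_length_le_Suc)
    ultimately show ?thesis
      using Load assms(2) by (auto simp: bounded_config_def intro: grow grow_add grow_diff)
  next
    case (Store pc i j X xs ys)
    have "\<bar>X i\<bar> \<le> 2 ^ b" "\<bar>X j\<bar> \<le> 2 ^ b"
      using assms(2) unfolding Store(1) by (simp_all add: bounded_config_def)
    moreover from this have "int_length (X i) \<le> b + 2" "int_length (X j) \<le> b + 2"
      by (simp_all only: int_length_le_Suc)
    ultimately show ?thesis
      using Store assms(2) by (auto simp: bounded_config_def intro: grow grow_add grow_diff)
  next
    case (Jump_Pos pc l j X xs ys)
    then have "\<bar>X j\<bar> \<le> 2 ^ b"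
      using assms(2) by (auto simp: bounded_config_def)
    moreover from this have "int_length (X j) \<le> b + 2"
      by (simp_all only: int_length_le_Suc)
    ultimately show ?thesis
      using Jump_Pos assms(2) by (auto simp: bounded_config_def intro: grow grow_add grow_diff)
  next
    case (Read pc i X x xs ys)
    then have "\<bar>x\<bar> \<le> 2 ^ b"
      using assms(2) by (auto simp: bounded_config_def)
    moreover from this have "int_length x \<le> b + 2"
      by (simp_all only: int_length_le_Suc)
    ultimately show ?thesis
      using Read assms(2) by (auto simp: bounded_config_def intro: grow grow_add grow_diff)
  next
    case (Print pc i X xs ys)
    then have "\<bar>X i\<bar> \<le> 2 ^ b"
      using assms(2) by (auto simp: bounded_config_def)
    moreover from this have "int_length (X i) \<le> b + 2"
      by (simp_all only: int_length_le_Suc)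
    ultimately show ?thesis
      using Print assms(2) by (auto simp: bounded_config_def intro: grow grow_add grow_diff)
  qed
qed

lemma exec_cost_le:
  assumes "exec P c t w ys" "bounded_config b c" "\<And>i k. Const i k \<in> set P \<Longrightarrow> \<bar>k\<bar> \<le> 2 ^ b"
  shows "w \<le> t * (2 * (b + t + 2))"
  using assms
proof (induction arbitrary: b rule: exec.induct)
  case (halt pc X xs ys)
  then show ?case by simp
next
  case (step c w c' t w' ys)
  have 1: "w \<le> 2 * (b + 2)" "bounded_config (Suc b) c'"
    using step_bounded[OF step.hyps(1) step.prems] by auto
  have "\<bar>k\<bar> \<le> 2 ^ Suc b" if "Const i k \<in> set P" for i k
    using step.prems(2)[OF that] by simp
  with 1(2) have "w' \<le> t * (2 * (Suc b + t + 2))"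
    using step.IH by blast
  with 1(1) have "w + w' \<le> 2 * (b + 2) + t * (2 * (Suc b + t + 2))"
    by (rule add_mono)
  also have "\<dots> \<le> (t + 1) * (2 * (b + (t + 1) + 2))"
    by (simp add: algebra_simps)
  finally show ?case .
qed

text \<open>The constant depends on the literals in the program.\<close>

lemma run_cost_le:
  obtains K where "\<And>xs t w ys. run P xs t w ys \<Longrightarrow> w \<le> t * (2 * (K + input_length xs + t))"
proof -
  define K where "K = (\<Sum>I\<leftarrow>P. case I of Const i k \<Rightarrow> int_length k | _ \<Rightarrow> 0)"
  have K: "\<bar>k\<bar> \<le> 2 ^ (K + l)" if "Const i k \<in> set P" for i k l
  proof -
    have "(case Const i k of Const i k \<Rightarrow> int_length k | _ \<Rightarrow> 0) \<le> K"
      unfolding K_def by (rule member_le_sum_list) (use that in \<open>force+\<close>)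
    then have "int_length k \<le> K + l"
      by simp
    then have "(2 :: int) ^ int_length k \<le> 2 ^ (K + l)"
      by (intro power_increasing) auto
    then show ?thesis
      using abs_le_two_pow_int_length[of k] by linarith
  qed
  have "w \<le> t * (2 * ((K + 2) + input_length xs + t))" if "run P xs t w ys" for xs t w ys
  proof -
    have "\<bar>x\<bar> \<le> 2 ^ (K + input_length xs)" if "x \<in> set xs" for x
    proof -
      have "(2 :: int) ^ int_length x \<le> 2 ^ (K + input_length xs)"
        using int_length_le_input_length[OF that] by (intro power_increasing) auto
      then show ?thesis
        using abs_le_two_pow_int_length[of x] by linarith
    qed
    then have "bounded_config (K + input_length xs) (0, \<lambda>_. 0, xs, [])"
      by (simp add: bounded_config_def)
    from exec_cost_le[OF that[unfolded run_def] this K]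
    show ?thesis
      by (simp add: algebra_simps)
  qed
  then show thesis
    by (rule that)
qed


section \<open>A loop language\<close>

text \<open>Programs are written in a small language with arrays and counting loops. Its variables hold the
sizes \<open>m\<close>, \<open>n\<close>, \<open>m - 1\<close>, \<open>n - 1\<close>, \<open>n + 1\<close>, the constants 0 and 1, loop counters and pointers, the parities
of a row and of an entry, and working values.\<close>

datatype var = Vm | Vn | Vm1 | Vn1 | Vn2 | Vzero | Vone | Vi | Vj | Vp | Vq | Vpar | Vrow | Vg
  | Vs | Vc | Vt | Vd | Vr | Vk | Vbad

datatype arr = Potential | Row_Min | Low_Count | Onset | Reach

text \<open>\<open>For i v c\<close> runs \<open>c\<close> with \<open>i = 0, 1, \<dots>, V v - 1\<close>. Since it is the only loop, the running time can be
bounded by recursion over the syntax as soon as bounds for the loop limits are known.\<close>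

datatype com =
    Assign var int
  | Plus var var var
  | Minus var var var
  | Shift var var int
  | Get var arr var
  | Put arr var var
  | Input var
  | Output var
  | Seq com com (infixr \<open>;;\<close> 60)
  | If_Le var var com
  | If_Less var var com
  | For var var com

type_synonym assertion = "(var \<Rightarrow> int) \<Rightarrow> (arr \<Rightarrow> nat \<Rightarrow> int) \<Rightarrow> int list \<Rightarrow> int list \<Rightarrow> bool"

text \<open>The last argument is the number of rounds that remain. The round is required to preserve the
counter and the limit, so that the compiled loop can recompute its exit test from them.\<close>

fun wp_loop :: "(assertion \<Rightarrow> assertion) \<Rightarrow> var \<Rightarrow> var \<Rightarrow> nat \<Rightarrow> assertion \<Rightarrow> nat \<Rightarrow> assertion" where
  "wp_loop W i v N Q 0 = Q"
| "wp_loop W i v N Q (Suc r) =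
     W (\<lambda>V M xs ys. V i = int (N - Suc r) \<and> V v = int N \<and>
          wp_loop W i v N Q r (V(i := V i + 1)) M xs ys)"

text \<open>Weakest preconditions for total correctness: array indices must be nonnegative and the input must not
be exhausted. A loop must run at least once, because the compiled loop
tests at the end of the body, and at most \<open>bd v\<close> times, which justifies the time bound.\<close>

primrec wp :: "(var \<Rightarrow> nat) \<Rightarrow> com \<Rightarrow> assertion \<Rightarrow> assertion" where
  "wp bd (Assign v k) Q V M xs ys = (Q (V(v := k)) M xs ys)"
| "wp bd (Plus v u w) Q V M xs ys = (Q (V(v := V u + V w)) M xs ys)"
| "wp bd (Minus v u w) Q V M xs ys = (Q (V(v := V u - V w)) M xs ys)"
| "wp bd (Shift v u k) Q V M xs ys = (Q (V(v := V u + k)) M xs ys)"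
| "wp bd (Get v a u) Q V M xs ys = (0 \<le> V u \<and> Q (V(v := M a (nat (V u)))) M xs ys)"
| "wp bd (Put a u v) Q V M xs ys = (0 \<le> V u \<and> Q V (M(a := (M a)(nat (V u) := V v))) xs ys)"
| "wp bd (Input v) Q V M xs ys = (xs \<noteq> [] \<and> Q (V(v := hd xs)) M (tl xs) ys)"
| "wp bd (Output v) Q V M xs ys = (Q V M xs (ys @ [V v]))"
| "wp bd (Seq c d) Q V M xs ys = wp bd c (wp bd d Q) V M xs ys"
| "wp bd (If_Le u v c) Q V M xs ys = (if V u \<le> V v then wp bd c Q V M xs ys else Q V M xs ys)"
| "wp bd (If_Less u v c) Q V M xs ys = (if V u < V v then wp bd c Q V M xs ys else Q V M xs ys)"
| "wp bd (For i v c) Q V M xs ys = (i \<noteq> v \<and> 0 < V v \<and> V v \<le> int (bd v) \<and>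
     wp_loop (wp bd c) i v (nat (V v)) Q (nat (V v)) (V(i := 0)) M xs ys)"

lemma wp_loop_mono:
  assumes "wp_loop W i v N Q r V M xs ys"
    and "\<And>V M xs ys. Q V M xs ys \<Longrightarrow> Q' V M xs ys"
    and "\<And>Q Q' V M xs ys. W Q V M xs ys \<Longrightarrow> (\<And>V M xs ys. Q V M xs ys \<Longrightarrow> Q' V M xs ys) \<Longrightarrow> W Q' V M xs ys"
  shows "wp_loop W i v N Q' r V M xs ys"
  using assms(1)
proof (induction r arbitrary: V M xs ys)
  case 0
  then show ?case by (simp add: assms(2))
next
  case (Suc r)
  show ?case
    using Suc.prems unfolding wp_loop.simps
    by (rule assms(3)) (use Suc.IH in blast)
qed

lemma wp_mono:
  assumes "wp bd c Q V M xs ys" "\<And>V M xs ys. Q V M xs ys \<Longrightarrow> Q' V M xs ys"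
  shows "wp bd c Q' V M xs ys"
  using assms
proof (induction c arbitrary: Q Q' V M xs ys)
  case (Seq c d)
  from Seq.prems(1) have "wp bd c (wp bd d Q) V M xs ys"
    by simp
  then have "wp bd c (wp bd d Q') V M xs ys"
    by (rule Seq.IH(1)) (rule Seq.IH(2)[OF _ Seq.prems(2)])
  then show ?case by simp
next
  case (For i v c)
  show ?case
    using For.prems(1) unfolding wp.simps
    by (auto intro!: wp_loop_mono[OF _ For.prems(2)] intro: For.IH)
qed (auto split: if_splits)

lemma wp_For:
  assumes "i \<noteq> v" "V v = int N" "0 < N" "N \<le> bd v"
    and "I 0 (V(i := 0)) M xs ys"
    and "\<And>k V M xs ys. \<lbrakk>k < N; V i = int k; V v = int N; I k V M xs ys\<rbrakk> \<Longrightarrow>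
      wp bd c (\<lambda>V M xs ys. V i = int k \<and> V v = int N \<and> I (Suc k) (V(i := V i + 1)) M xs ys) V M xs ys"
    and "\<And>V M xs ys. \<lbrakk>V i = int N; V v = int N; I N V M xs ys\<rbrakk> \<Longrightarrow> Q V M xs ys"
  shows "wp bd (For i v c) Q V M xs ys"
proof -
  have "wp_loop (wp bd c) i v N Q r V M xs ys"
    if "r \<le> N" "I (N - r) V M xs ys" "V i = int (N - r)" "V v = int N" for r V M xs ys
    using that
  proof (induction r arbitrary: V M xs ys)
    case 0
    then show ?case by (simp add: assms(7))
  next
    case (Suc r)
    have "wp bd c (\<lambda>V M xs ys. V i = int (N - Suc r) \<and> V v = int N \<and>
        I (Suc (N - Suc r)) (V(i := V i + 1)) M xs ys) V M xs ys"
      by (rule assms(6)) (use Suc.prems in auto)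
    then show ?case
      unfolding wp_loop.simps
      by (rule wp_mono) (use Suc.prems assms(1) Suc.IH in \<open>auto simp: Suc_diff_Suc\<close>)
  qed
  from this[of N "V(i := 0)"] show ?thesis
    using assms(1-5) by simp
qed


section \<open>Compilation to random access machines\<close>

text \<open>Registers 0 and 1 are scratch space, registers below 24 hold the variables, and the arrays are
interleaved with stride 8 from register 24 on. In this way arrays of unknown length
never overlap, and an address is computed by three doublings and one addition.\<close>

fun reg :: "var \<Rightarrow> nat" where
  "reg Vm = 2" | "reg Vn = 3" | "reg Vm1 = 4" | "reg Vn1 = 5" | "reg Vn2 = 6" | "reg Vzero = 7"
| "reg Vone = 8" | "reg Vi = 9" | "reg Vj = 10" | "reg Vp = 11" | "reg Vq = 12" | "reg Vpar = 13"
| "reg Vrow = 14" | "reg Vg = 15" | "reg Vs = 16" | "reg Vc = 17" | "reg Vt = 18" | "reg Vd = 19"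
| "reg Vr = 20" | "reg Vk = 21" | "reg Vbad = 22"

fun base :: "arr \<Rightarrow> nat" where
  "base Potential = 24" | "base Row_Min = 25" | "base Low_Count = 26" | "base Onset = 27" | "base Reach = 28"

definition cell :: "arr \<Rightarrow> nat \<Rightarrow> nat" where
  "cell a x = base a + 8 * x"

lemma reg_bounds [simp]: "1 < reg v" "reg v < 24"
  by (cases v; simp)+

lemma reg_inj [simp]: "reg u = reg v \<longleftrightarrow> u = v"
  by (cases u; cases v; simp)

lemma cell_inj [simp]: "cell a x = cell b y \<longleftrightarrow> a = b \<and> x = y"
proof
  assume eq: "cell a x = cell b y"
  have div: "cell a x div 8 = x + 3" "cell b y div 8 = y + 3"
    by (cases a; cases b; simp add: cell_def)+
  have "x = y"
    using div eq by simp
  with eq have "base a = base b"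
    by (simp add: cell_def)
  then have "a = b"
    by (cases a; cases b; simp)
  with \<open>x = y\<close> show "a = b \<and> x = y" by simp
qed simp

lemma cell_ge: "24 \<le> cell a x"
  by (cases a) (simp_all add: cell_def)

lemma reg_neq_cell [simp]: "reg v \<noteq> cell a x" "cell a x \<noteq> reg v"
  using cell_ge[of a x] reg_bounds(2)[of v] by linarith+

lemma scratch_neq [simp]:
  "reg v \<noteq> 0" "reg v \<noteq> Suc 0" "cell a x \<noteq> 0" "cell a x \<noteq> Suc 0"
  "0 \<noteq> reg v" "Suc 0 \<noteq> reg v" "0 \<noteq> cell a x" "Suc 0 \<noteq> cell a x"
  using cell_ge[of a x] reg_bounds(1)[of v] by linarith+

definition address :: "arr \<Rightarrow> var \<Rightarrow> instr list" where
  "address a u = [Add 0 (reg u) (reg u), Add 0 0 0, Add 0 0 0, Const 1 (int (base a)), Add 0 0 1]"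

text \<open>Jumps are taken on positive values only: \<open>If_Le\<close> skips its body if \<open>u - v\<close> is positive, and
\<open>If_Less\<close> if \<open>u - v + 1\<close> is positive. \<open>compile c b\<close> is the code for the absolute address \<open>b\<close>.\<close>

primrec compile :: "com \<Rightarrow> nat \<Rightarrow> instr list" where
  "compile (Assign v k) = (\<lambda>b. [Const (reg v) k])"
| "compile (Plus v u w) = (\<lambda>b. [Add (reg v) (reg u) (reg w)])"
| "compile (Minus v u w) = (\<lambda>b. [Sub (reg v) (reg u) (reg w)])"
| "compile (Shift v u k) = (\<lambda>b. [Const 0 k, Add (reg v) (reg u) 0])"
| "compile (Get v a u) = (\<lambda>b. address a u @ [Load (reg v) 0])"
| "compile (Put a u v) = (\<lambda>b. address a u @ [Store 0 (reg v)])"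
| "compile (Input v) = (\<lambda>b. [Read (reg v)])"
| "compile (Output v) = (\<lambda>b. [Print (reg v)])"
| "compile (Seq c d) = (\<lambda>b. compile c b @ compile d (b + length (compile c b)))"
| "compile (If_Le u v c) = (\<lambda>b.
     [Sub 0 (reg u) (reg v), Jump_Pos (b + 2 + length (compile c (b + 2))) 0] @ compile c (b + 2))"
| "compile (If_Less u v c) = (\<lambda>b.
     [Sub 0 (reg u) (reg v), Const 1 1, Add 0 0 1, Jump_Pos (b + 4 + length (compile c (b + 4))) 0] @
     compile c (b + 4))"
| "compile (For i v c) = (\<lambda>b. Const (reg i) 0 # compile c (b + 1) @
     [Const 0 1, Add (reg i) (reg i) 0, Sub 0 (reg v) (reg i), Jump_Pos (b + 1) 0])"

primrec time_bound :: "(var \<Rightarrow> nat) \<Rightarrow> com \<Rightarrow> nat" where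
  "time_bound bd (Assign v k) = 1"
| "time_bound bd (Plus v u w) = 1"
| "time_bound bd (Minus v u w) = 1"
| "time_bound bd (Shift v u k) = 2"
| "time_bound bd (Get v a u) = 6"
| "time_bound bd (Put a u v) = 6"
| "time_bound bd (Input v) = 1"
| "time_bound bd (Output v) = 1"
| "time_bound bd (Seq c d) = time_bound bd c + time_bound bd d"
| "time_bound bd (If_Le u v c) = 2 + time_bound bd c"
| "time_bound bd (If_Less u v c) = 4 + time_bound bd c"
| "time_bound bd (For i v c) = 1 + bd v * (time_bound bd c + 4)"

primrec code_at :: "instr list \<Rightarrow> nat \<Rightarrow> instr list \<Rightarrow> bool" where
  "code_at P b [] = True"
| "code_at P b (I # Is) = (b < length P \<and> P ! b = I \<and> code_at P (Suc b) Is)"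

lemma code_at_append [simp]:
  "code_at P b (xs @ ys) \<longleftrightarrow> code_at P b xs \<and> code_at P (b + length xs) ys"
  by (induction xs arbitrary: b) auto

lemma code_at_self: "code_at (pre @ xs @ post) (length pre) xs"
proof (induction xs arbitrary: pre)
  case (Cons x xs)
  from Cons[of "pre @ [x]"] show ?case by (simp add: nth_append)
qed simp

text \<open>Runs are composed backwards from halting executions. The logarithmic cost is left existential: it is
recovered from the number of steps by \<open>exec_cost_le\<close>.\<close>

definition leads :: "instr list \<Rightarrow> config \<Rightarrow> nat \<Rightarrow> config \<Rightarrow> bool" where
  "leads P c t c' \<longleftrightarrow> (\<forall>t' w' ys. exec P c' t' w' ys \<longrightarrow> (\<exists>w. exec P c (t + t') w ys))"

lemma leads_refl: "leads P c 0 c"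
  by (auto simp: leads_def)

lemma leads_trans: "leads P c t c' \<Longrightarrow> leads P c' t' c'' \<Longrightarrow> leads P c (t + t') c''"
  unfolding leads_def by (metis add.assoc)

lemma leads_step: "step P c w c' \<Longrightarrow> leads P c' t c'' \<Longrightarrow> leads P c (Suc t) c''"
  unfolding leads_def by (metis exec.step add_Suc Suc_eq_plus1)

text \<open>Symbolic execution rules for the instructions other than \<open>Halt\<close>.\<close>

lemma leads_Const:
  "\<lbrakk>pc < length P; P ! pc = Const i k; leads P (Suc pc, X(i := k), xs, ys) t c\<rbrakk> \<Longrightarrow>
   leads P (pc, X, xs, ys) (Suc t) c"
  by (rule leads_step[OF step.Const]) auto

lemma leads_Add:
  "\<lbrakk>pc < length P; P ! pc = Add i j k; leads P (Suc pc, X(i := X j + X k), xs, ys) t c\<rbrakk> \<Longrightarrow>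
   leads P (pc, X, xs, ys) (Suc t) c"
  by (rule leads_step[OF step.Add]) auto

lemma leads_Sub:
  "\<lbrakk>pc < length P; P ! pc = Sub i j k; leads P (Suc pc, X(i := X j - X k), xs, ys) t c\<rbrakk> \<Longrightarrow>
   leads P (pc, X, xs, ys) (Suc t) c"
  by (rule leads_step[OF step.Sub]) auto

lemma leads_Load:
  "\<lbrakk>pc < length P; P ! pc = Load i j; 0 \<le> X j;
    leads P (Suc pc, X(i := X (nat (X j))), xs, ys) t c\<rbrakk> \<Longrightarrow>
   leads P (pc, X, xs, ys) (Suc t) c"
  by (rule leads_step[OF step.Load]) auto

lemma leads_Store:
  "\<lbrakk>pc < length P; P ! pc = Store i j; 0 \<le> X i;
    leads P (Suc pc, X(nat (X i) := X j), xs, ys) t c\<rbrakk> \<Longrightarrow>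
   leads P (pc, X, xs, ys) (Suc t) c"
  by (rule leads_step[OF step.Store]) auto

lemma leads_Read:
  "\<lbrakk>pc < length P; P ! pc = Read i; xs \<noteq> [];
    leads P (Suc pc, X(i := hd xs), tl xs, ys) t c\<rbrakk> \<Longrightarrow>
   leads P (pc, X, xs, ys) (Suc t) c"
  by (cases xs) (auto intro: leads_step[OF step.Read])

lemma leads_Print:
  "\<lbrakk>pc < length P; P ! pc = Print i; leads P (Suc pc, X, xs, ys @ [X i]) t c\<rbrakk> \<Longrightarrow>
   leads P (pc, X, xs, ys) (Suc t) c"
  by (rule leads_step[OF step.Print]) auto

lemma leads_Jump_Pos:
  "\<lbrakk>pc < length P; P ! pc = Jump_Pos l j;
    leads P (if 0 < X j then l else Suc pc, X, xs, ys) t c\<rbrakk> \<Longrightarrow>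
   leads P (pc, X, xs, ys) (Suc t) c"
  by (rule leads_step[OF step.Jump_Pos]) auto

definition represents :: "(nat \<Rightarrow> int) \<Rightarrow> (var \<Rightarrow> int) \<Rightarrow> (arr \<Rightarrow> nat \<Rightarrow> int) \<Rightarrow> bool" where
  "represents X V M \<longleftrightarrow> (\<forall>v. X (reg v) = V v) \<and> (\<forall>a x. X (cell a x) = M a x)"

lemma represents_scratch [simp]:
  "represents (X(0 := k)) V M \<longleftrightarrow> represents X V M"
  "represents (X(Suc 0 := k)) V M \<longleftrightarrow> represents X V M"
  by (auto simp: represents_def)

lemma represents_reg: "represents X V M \<Longrightarrow> represents (X(reg v := k)) (V(v := k)) M"
  by (auto simp: represents_def)

lemma represents_cell:
  "represents X V M \<Longrightarrow> represents (X(cell a x := k)) V (M(a := (M a)(x := k)))"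
  by (auto simp: represents_def)

lemma leads_address:
  assumes "code_at P b (address a u)" "represents X V M" "0 \<le> V u"
  obtains X' where "represents X' V M" "X' 0 = int (cell a (nat (V u)))"
    "\<And>t c. leads P (b + 5, X', xs, ys) t c \<Longrightarrow> leads P (b, X, xs, ys) (5 + t) c"
proof -
  have Xu: "X (reg u) = V u"
    using assms(2) by (simp add: represents_def)
  define X3 where "X3 = X(0 := 8 * V u)"
  define X' where "X' = X3(1 := int (base a), 0 := int (cell a (nat (V u))))"
  have "leads P (b, X, xs, ys) (5 + t) c" if *: "leads P (b + 5, X', xs, ys) t c" for t c
  proof -
    \<comment> \<open>From the last instruction backwards, register 0 holds \<open>8 * V u\<close>, \<open>4 * V u\<close> and \<open>2 * V u\<close>.\<close>
    have five: "b + 5 = Suc (Suc (Suc (Suc (Suc b))))" by simp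
    have "leads P (Suc (Suc (Suc (Suc b))), X3(1 := int (base a)), xs, ys) (Suc t) c"
      by (rule leads_Add[of _ _ 0 0 1]) 
        (use assms(1,3) *[unfolded five] in \<open>simp_all add: address_def X'_def X3_def cell_def add.commute\<close>)
    then have "leads P (Suc (Suc (Suc b)), X3, xs, ys) (Suc (Suc t)) c"
      by - (rule leads_Const[of _ _ 1 "int (base a)"]; use assms(1) in \<open>simp add: address_def\<close>)
    then have "leads P (Suc (Suc b), X(0 := 4 * V u), xs, ys) (Suc (Suc (Suc t))) c"
      by - (rule leads_Add[of _ _ 0 0 0]; use assms(1) in \<open>simp add: address_def X3_def\<close>)
    then have "leads P (Suc b, X(0 := 2 * V u), xs, ys) (Suc (Suc (Suc (Suc t)))) c"
      by - (rule leads_Add[of _ _ 0 0 0]; use assms(1) in \<open>simp add: address_def\<close>)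
    then have "leads P (b, X, xs, ys) (Suc (Suc (Suc (Suc (Suc t))))) c"
      by - (rule leads_Add[of _ _ 0 "reg u" "reg u"]; use assms(1) in \<open>simp add: address_def Xu\<close>)
    then show ?thesis by (simp add: numeral_eq_Suc)
  qed
  moreover have "represents X' V M"
    using assms(2) by (simp add: X'_def X3_def)
  ultimately show thesis
    using that[of X'] by (simp add: X'_def)
qed

definition simulated :: "instr list \<Rightarrow> nat \<Rightarrow> nat \<Rightarrow> assertion \<Rightarrow> nat \<Rightarrow>
    (nat \<Rightarrow> int) \<Rightarrow> int list \<Rightarrow> int list \<Rightarrow> bool" where
  "simulated P b e Q T X xs ys \<longleftrightarrow> (\<exists>V M xs' ys' X' t. Q V M xs' ys' \<and> represents X' V M \<and>
     t \<le> T \<and> leads P (b, X, xs, ys) t (e, X', xs', ys'))"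

lemma simulatedI:
  "\<lbrakk>\<And>t c. leads P (e, X', xs', ys') t c \<Longrightarrow> leads P (b, X, xs, ys) (T + t) c;
    Q V M xs' ys'; represents X' V M\<rbrakk> \<Longrightarrow> simulated P b e Q T X xs ys"
  unfolding simulated_def using leads_refl[of P "(e, X', xs', ys')"] by (metis add.right_neutral order_refl)

lemma simulated_prepend:
  "\<lbrakk>\<And>t c. leads P (d, X', xs', ys') t c \<Longrightarrow> leads P (b, X, xs, ys) (T + t) c;
    simulated P d e Q T' X' xs' ys'\<rbrakk> \<Longrightarrow> simulated P b e Q (T + T') X xs ys"
  unfolding simulated_def by (meson add_left_mono)

lemma simulated_trans:
  assumes "simulated P b d R T X xs ys"
    and "\<And>V M X xs ys. \<lbrakk>R V M xs ys; represents X V M\<rbrakk> \<Longrightarrow> simulated P d e Q T' X xs ys"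
  shows "simulated P b e Q (T + T') X xs ys"
proof -
  from assms(1) obtain V M xs' ys' X' t where
    *: "R V M xs' ys'" "represents X' V M" "t \<le> T" "leads P (b, X, xs, ys) t (d, X', xs', ys')"
    unfolding simulated_def by blast
  from assms(2)[OF *(1,2)] obtain V' M' xs'' ys'' X'' t' where
    "Q V' M' xs'' ys''" "represents X'' V' M'" "t' \<le> T'"
    "leads P (d, X', xs', ys') t' (e, X'', xs'', ys'')"
    unfolding simulated_def by blast
  with * show ?thesis
    unfolding simulated_def using leads_trans add_mono by meson
qed

lemma simulated_mono: "simulated P b e Q T X xs ys \<Longrightarrow> T \<le> T' \<Longrightarrow> simulated P b e Q T' X xs ys"
  unfolding simulated_def by (meson order_trans)

text \<open>The body occupies the addresses from \<open>b\<close> to \<open>d\<close>; the four instructions at \<open>d\<close> increment the counter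
and jump back.\<close>

lemma simulated_loop:
  assumes body: "\<And>Q V M xs ys X. \<lbrakk>W Q V M xs ys; represents X V M\<rbrakk> \<Longrightarrow> simulated P b d Q T X xs ys"
    and code: "code_at P d [Const 0 1, Add (reg i) (reg i) 0, Sub 0 (reg v) (reg i), Jump_Pos b 0]"
    and "i \<noteq> v" "0 < r" "r \<le> N" "V v = int N" "V i = int (N - r)"
    and "wp_loop W i v N Q r V M xs ys" "represents X V M"
  shows "simulated P b (d + 4) Q (r * (T + 4)) X xs ys"
  using assms(4-)
proof (induction r arbitrary: V M X xs ys)
  case 0
  then show ?case by simp
next
  case (Suc r)
  let ?R = "\<lambda>V M xs ys. V i = int (N - Suc r) \<and> V v = int N \<and>
    wp_loop W i v N Q r (V(i := V i + 1)) M xs ys"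
  have "simulated P b d ?R T X xs ys"
    by (rule body) (use Suc.prems in simp_all)
  then have "simulated P b (d + 4) Q (T + (4 + r * (T + 4))) X xs ys"
  proof (rule simulated_trans)
    fix V M X xs ys
    assume R: "?R V M xs ys" and rep: "represents X V M"
    define X' where "X' = X(0 := int N - (V i + 1), reg i := V i + 1)"
    have X: "X (reg i) = V i" "X (reg v) = int N"
      using rep R by (simp_all add: represents_def)
    have rep': "represents X' (V(i := V i + 1)) M"
      unfolding X'_def using represents_reg[of "X(0 := int N - (V i + 1))"] rep by simp
    have lead: "leads P (d, X, xs, ys) (4 + t) c"
      if "leads P (if 0 < r then b else d + 4, X', xs, ys) t c" for t c
    proof -
      have four: "d + 4 = Suc (Suc (Suc (Suc d)))" by simp
      have "leads P (Suc (Suc (Suc d)), X', xs, ys) (Suc t) c"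
        by - (rule leads_Jump_Pos[of _ _ b 0];
            use code that[unfolded four] R Suc.prems(2) in \<open>auto simp: X'_def split: if_splits\<close>)
      then have "leads P (Suc (Suc d), X(0 := 1, reg i := V i + 1), xs, ys) (Suc (Suc t)) c"
        using code X R \<open>i \<noteq> v\<close> by - (rule leads_Sub[of _ _ 0 "reg v" "reg i"]; auto simp: X'_def fun_upd_twist fun_upd_upd)
      then have "leads P (Suc d, X(0 := 1), xs, ys) (Suc (Suc (Suc t))) c"
        using code X by - (rule leads_Add[of _ _ "reg i" "reg i" 0]; auto)
      then have "leads P (d, X, xs, ys) (Suc (Suc (Suc (Suc t)))) c"
        using code by - (rule leads_Const[of _ _ 0 1]; auto)
      then show ?thesis by (simp add: numeral_eq_Suc)
    qed
    show "simulated P d (d + 4) Q (4 + r * (T + 4)) X xs ys"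
    proof (cases "r = 0")
      case True
      have "simulated P d (d + 4) Q 4 X xs ys"
        by (rule simulatedI[OF _ _ rep']) (use lead R True in auto)
      with True show ?thesis by simp
    next
      case False
      have "simulated P b (d + 4) Q (r * (T + 4)) X' xs ys"
        by (rule Suc.IH[OF _ _ _ _ conjunct2[OF conjunct2[OF R]] rep']) (use False R Suc.prems(2) \<open>i \<noteq> v\<close> in auto)
      then show ?thesis
        by (rule simulated_prepend[rotated]) (use lead False in auto)
    qed
  qed
  then show ?case
    by (simp add: algebra_simps)
qed

lemma compile_correct:
  assumes "wp bd c Q V M xs ys" "code_at P b (compile c b)" "represents X V M"
  shows "simulated P b (b + length (compile c b)) Q (time_bound bd c) X xs ys"
  using assms
proof (induction c arbitrary: Q V M xs ys b X)
  case (Assign v k)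
  show ?case
  proof (rule simulatedI)
    show "represents (X(reg v := k)) (V(v := k)) M"
      by (rule represents_reg[OF Assign(3)])
    show "Q (V(v := k)) M xs ys"
      using Assign(1) by simp
  qed (use Assign(2) in \<open>simp add: leads_Const\<close>)
next
  case (Plus v u w)
  show ?case
  proof (rule simulatedI)
    show "represents (X(reg v := V u + V w)) (V(v := V u + V w)) M"
      by (rule represents_reg[OF Plus(3)])
    show "Q (V(v := V u + V w)) M xs ys"
      using Plus(1) by simp
  qed (use Plus(2,3) in \<open>simp add: leads_Add represents_def\<close>)
next
  case (Minus v u w)
  show ?case
  proof (rule simulatedI)
    show "represents (X(reg v := V u - V w)) (V(v := V u - V w)) M"
      by (rule represents_reg[OF Minus(3)])
    show "Q (V(v := V u - V w)) M xs ys"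
      using Minus(1) by simp
  qed (use Minus(2,3) in \<open>simp add: leads_Sub represents_def\<close>)
next
  case (Shift v u k)
  then have rep: "represents (X(0 := k)) V M" by simp
  show ?case
  proof (rule simulatedI)
    show "represents (X(0 := k, reg v := V u + k)) (V(v := V u + k)) M"
      by (rule represents_reg[OF rep])
    show "Q (V(v := V u + k)) M xs ys"
      using Shift(1) by simp
  qed (use Shift(2,3) in \<open>simp add: leads_Const leads_Add represents_def\<close>)
next
  case (Get v a u)
  then obtain X' where X': "represents X' V M" "X' 0 = int (cell a (nat (V u)))"
    "\<And>t c. leads P (b + 5, X', xs, ys) t c \<Longrightarrow> leads P (b, X, xs, ys) (5 + t) c"
    using leads_address by (metis compile.simps(5) code_at_append wp.simps(5))
  have len: "length (compile (Get v a u) b) = 6" "length (address a u) = 5"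
    by (simp_all add: address_def)
  have "simulated P (b + 5) (b + 6) Q 1 X' xs ys"
  proof (rule simulatedI[OF _ _ represents_reg[OF X'(1), of v "M a (nat (V u))"]])
    show "leads P (b + 5, X', xs, ys) (1 + t) c"
      if "leads P (b + 6, X'(reg v := M a (nat (V u))), xs, ys) t c" for t c
      using leads_Load[of "b + 5" P "reg v" 0 X' xs ys t c] that X'(1,2) Get(2) len
      by (simp add: represents_def numeral_eq_Suc)
    show "Q (V(v := M a (nat (V u)))) M xs ys"
      using Get(1) by simp
  qed
  then have "simulated P b (b + 6) Q (5 + 1) X xs ys"
    by (rule simulated_prepend[rotated]) (rule X'(3))
  then show ?case
    by (simp add: len)
next
  case (Put a u v)
  then obtain X' where X': "represents X' V M" "X' 0 = int (cell a (nat (V u)))"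
    "\<And>t c. leads P (b + 5, X', xs, ys) t c \<Longrightarrow> leads P (b, X, xs, ys) (5 + t) c"
    using leads_address by (metis compile.simps(6) code_at_append wp.simps(6))
  have len: "length (compile (Put a u v) b) = 6" "length (address a u) = 5"
    by (simp_all add: address_def)
  have "simulated P (b + 5) (b + 6) Q 1 X' xs ys"
  proof (rule simulatedI[OF _ _ represents_cell[OF X'(1), of a "nat (V u)" "V v"]])
    show "leads P (b + 5, X', xs, ys) (1 + t) c"
      if "leads P (b + 6, X'(cell a (nat (V u)) := V v), xs, ys) t c" for t c
      using leads_Store[of "b + 5" P 0 "reg v" X' xs ys t c] that X'(1,2) Put(2) len
      by (simp add: represents_def numeral_eq_Suc)
    show "Q V (M(a := (M a)(nat (V u) := V v))) xs ys"
      using Put(1) by simp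
  qed
  then have "simulated P b (b + 6) Q (5 + 1) X xs ys"
    by (rule simulated_prepend[rotated]) (rule X'(3))
  then show ?case
    by (simp add: len)
next
  case (Input v)
  show ?case
  proof (rule simulatedI)
    show "represents (X(reg v := hd xs)) (V(v := hd xs)) M"
      by (rule represents_reg[OF Input(3)])
    show "Q (V(v := hd xs)) M (tl xs) ys"
      using Input(1) by simp
  qed (use Input(1,2) in \<open>simp add: leads_Read\<close>)
next
  case (Output v)
  show ?case
  proof (rule simulatedI)
    show "represents X V M"
      by (rule Output(3))
    show "Q V M xs (ys @ [V v])"
      using Output(1) by simp
  qed (use Output(2,3) in \<open>simp add: leads_Print represents_def\<close>)
next
  case (Seq c d)
  have "simulated P b (b + length (compile c b)) (wp bd d Q) (time_bound bd c) X xs ys"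
    by (rule Seq.IH(1)) (use Seq.prems in auto)
  then have "simulated P b (b + length (compile c b) + length (compile d (b + length (compile c b)))) Q
      (time_bound bd c + time_bound bd d) X xs ys"
    by (rule simulated_trans) (use Seq.IH(2) Seq.prems(2) in auto)
  then show ?case
    by (simp add: add.assoc)
next
  case (If_Le u v c)
  let ?X = "X(0 := V u - V v)"
  let ?e = "b + 2 + length (compile c (b + 2))"
  have rep: "represents ?X V M"
    using If_Le.prems(3) by simp
  have lead: "leads P (b, X, xs, ys) (2 + t) c'"
    if "leads P (if V u \<le> V v then b + 2 else ?e, ?X, xs, ys) t c'" for t c'
  proof -
    have "leads P (Suc b, ?X, xs, ys) (Suc t) c'"
      by - (rule leads_Jump_Pos[of _ _ ?e 0]; use If_Le.prems(2) that in \<open>auto split: if_splits\<close>)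
    then have "leads P (b, X, xs, ys) (Suc (Suc t)) c'"
      using If_Le.prems(2,3) by - (rule leads_Sub[of _ _ 0 "reg u" "reg v"]; auto simp: represents_def)
    then show ?thesis by (simp add: numeral_eq_Suc)
  qed
  have "simulated P b ?e Q (2 + time_bound bd c) X xs ys"
  proof (cases "V u \<le> V v")
    case True
    have "simulated P (b + 2) ?e Q (time_bound bd c) ?X xs ys"
      by (rule If_Le.IH[OF _ _ rep]) (use True If_Le.prems in \<open>auto simp: numeral_eq_Suc\<close>)
    then show ?thesis
      by (rule simulated_prepend[rotated]) (use lead True in auto)
  next
    case False
    have "simulated P b ?e Q 2 X xs ys"
      by (rule simulatedI[OF _ _ rep]) (use lead False If_Le.prems in auto)
    then show ?thesis
      by (rule simulated_mono) simp
  qed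
  then show ?case
    by (simp add: add.assoc)
next
  case (If_Less u v c)
  let ?X = "X(0 := V u - V v + 1, Suc 0 := 1)"
  let ?e = "b + 4 + length (compile c (b + 4))"
  have rep: "represents ?X V M"
    using If_Less.prems(3) by simp
  have lead: "leads P (b, X, xs, ys) (4 + t) c'"
    if "leads P (if V u < V v then b + 4 else ?e, ?X, xs, ys) t c'" for t c'
  proof -
    have four: "b + 4 = Suc (Suc (Suc (Suc b)))" by simp
    have "leads P (Suc (Suc (Suc b)), ?X, xs, ys) (Suc t) c'"
      by - (rule leads_Jump_Pos[of _ _ ?e 0]; use If_Less.prems(2) that in \<open>auto simp: four split: if_splits\<close>)
    then have "leads P (Suc (Suc b), X(0 := V u - V v, Suc 0 := 1), xs, ys) (Suc (Suc t)) c'"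
      using If_Less.prems(2) by - (rule leads_Add[of _ _ 0 0 1]; auto simp: fun_upd_twist)
    then have "leads P (Suc b, X(0 := V u - V v), xs, ys) (Suc (Suc (Suc t))) c'"
      using If_Less.prems(2) by - (rule leads_Const[of _ _ 1 1]; auto)
    then have "leads P (b, X, xs, ys) (Suc (Suc (Suc (Suc t)))) c'"
      using If_Less.prems(2,3) by - (rule leads_Sub[of _ _ 0 "reg u" "reg v"]; auto simp: represents_def)
    then show ?thesis by (simp add: numeral_eq_Suc)
  qed
  have "simulated P b ?e Q (4 + time_bound bd c) X xs ys"
  proof (cases "V u < V v")
    case True
    have "simulated P (b + 4) ?e Q (time_bound bd c) ?X xs ys"
      by (rule If_Less.IH[OF _ _ rep]) (use True If_Less.prems in \<open>auto simp: numeral_eq_Suc\<close>)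
    then show ?thesis
      by (rule simulated_prepend[rotated]) (use lead True in auto)
  next
    case False
    have "simulated P b ?e Q 4 X xs ys"
      by (rule simulatedI[OF _ _ rep]) (use lead False If_Less.prems in auto)
    then show ?thesis
      by (rule simulated_mono) simp
  qed
  then show ?case
    by (simp add: numeral_eq_Suc)
next
  case (For i v c)
  define N where "N = nat (V v)"
  define d where "d = b + 1 + length (compile c (b + 1))"
  have N: "i \<noteq> v" "0 < N" "V v = int N" "N \<le> bd v"
    and loop: "wp_loop (wp bd c) i v N Q N (V(i := 0)) M xs ys"
    using For.prems(1) by (auto simp: N_def)
  have code: "code_at P d [Const 0 1, Add (reg i) (reg i) 0, Sub 0 (reg v) (reg i), Jump_Pos (b + 1) 0]"
    "code_at P (b + 1) (compile c (b + 1))"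
    using For.prems(2) by (simp_all add: d_def)
  have "simulated P (b + 1) (d + 4) Q (N * (time_bound bd c + 4)) (X(reg i := 0)) xs ys"
  proof (rule simulated_loop[OF _ code(1) N(1,2) order_refl _ _ loop])
    show "simulated P (b + 1) d Q (time_bound bd c) X xs ys"
      if "wp bd c Q V M xs ys" "represents X V M" for Q V M xs ys X
      unfolding d_def by (rule For.IH[OF that(1) code(2) that(2)])
  qed (use N For.prems(3) in \<open>simp_all add: represents_reg\<close>)
  then have "simulated P b (d + 4) Q (1 + N * (time_bound bd c + 4)) X xs ys"
    by (rule simulated_prepend[rotated]) (use For.prems(2) in \<open>auto intro: leads_Const\<close>)
  then have "simulated P b (d + 4) Q (time_bound bd (For i v c)) X xs ys"
    by (rule simulated_mono) (use N(4) in simp)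
  then show ?case
    by (simp add: d_def numeral_eq_Suc)
qed

definition program :: "com \<Rightarrow> instr list" where
  "program c = compile c 0 @ [Halt]"

lemma run_program:
  assumes "wp bd c Q (\<lambda>_. 0) (\<lambda>_ _. 0) xs []"
  obtains t w V M xs' ys where "run (program c) xs t w ys" "t \<le> time_bound bd c + 1" "Q V M xs' ys"
proof -
  have "code_at (program c) 0 (compile c 0)"
    using code_at_self[of "[]" "compile c 0" "[Halt]"] by (simp add: program_def)
  from compile_correct[OF assms this, of "\<lambda>_. 0"] obtain V M xs' ys X t where
    *: "Q V M xs' ys" "t \<le> time_bound bd c"
    "leads (program c) (0, \<lambda>_. 0, xs, []) t (length (compile c 0), X, xs', ys)"
    by (auto simp: simulated_def represents_def)
  have "exec (program c) (length (compile c 0), X, xs', ys) 1 1 ys"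
    by (rule exec.halt) (simp_all add: program_def)
  with *(3) obtain w where "run (program c) xs (t + 1) w ys"
    unfolding leads_def run_def by blast
  with * show thesis
    by (intro that) auto
qed


section \<open>The program\<close>

definition read_size :: com where
  "read_size =
     Input Vm ;; Input Vn ;; Shift Vm1 Vm (-1) ;; Shift Vn1 Vn (-1) ;; Shift Vn2 Vn 1 ;; Assign Vone 1"

text \<open>The potential is stored in row-major order. \<open>Vg\<close> accumulates the mixed differences of the
current row, so that the entry above plus \<open>Vg\<close> is the next entry. Row 0 and column 0 keep the value 0 that
registers have at the start.\<close>

definition build_potential :: com where
  "build_potential =
     Assign Vrow 0 ;; Plus Vp Vn Vzero ;;
     For Vi Vm1 (
       Plus Vpar Vrow Vzero ;; Assign Vg 0 ;; Shift Vp Vp 1 ;;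
       For Vj Vn1 (
         Input Vs ;; Shift Vs Vs (-2) ;; If_Less Vzero Vpar (Minus Vs Vzero Vs) ;;
         Plus Vg Vg Vs ;;
         Minus Vq Vp Vn ;; Get Vc Potential Vq ;; Plus Vc Vc Vg ;; Put Potential Vp Vc ;;
         Minus Vpar Vone Vpar ;; Shift Vp Vp 1) ;;
       Minus Vrow Vone Vrow)"

definition compute_rows :: com where
  "compute_rows =
     Assign Vp 0 ;;
     For Vi Vm (
       Assign Vc 0 ;; Assign Vt 0 ;;
       For Vj Vn (
         Get Vd Potential Vp ;;
         If_Less Vd Vc (Plus Vc Vd Vzero ;; Assign Vt 0) ;;
         If_Le Vd Vc (Shift Vt Vt 1) ;;
         Shift Vp Vp 1) ;;
       Put Row_Min Vi Vc ;; Put Low_Count Vi Vt)"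

definition compute_onset :: com where
  "compute_onset =
     For Vj Vn (
       Plus Vq Vn Vzero ;; Plus Vp Vj Vzero ;;
       For Vi Vm (
         Get Vd Potential Vp ;; Get Vc Row_Min Vi ;; Get Vt Low_Count Vi ;;
         If_Le Vd Vc (If_Le Vt Vq (Plus Vq Vt Vzero)) ;;
         Plus Vp Vp Vn) ;;
       Put Onset Vj Vq)"

text \<open>Entry \<open>q\<close> of \<open>Reach\<close> becomes the largest lower bound on \<open>k\<close> that comes into force once \<open>k\<close> is at
least \<open>q\<close>. An unconditional lower bound is recorded at \<open>q = 0\<close>.\<close>

definition compute_reach :: com where
  "compute_reach =
     Assign Vp 0 ;;
     For Vi Vm (
       Get Vc Row_Min Vi ;; Get Vt Low_Count Vi ;;
       For Vj Vn (
         Get Vd Potential Vp ;; Minus Vd Vd Vc ;;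
         If_Le Vone Vd (
           Assign Vq 0 ;; If_Le Vd Vone (Get Vq Onset Vj) ;;
           Get Vr Reach Vq ;; If_Le Vr Vt (Put Reach Vq Vt)) ;;
         Shift Vp Vp 1))"

text \<open>One scan suffices. An index \<open>q\<close> is skipped only if it exceeds the current \<open>k\<close>; then all later
indices exceed it as well, and \<open>k\<close> has its final value.\<close>

definition least_closed :: com where
  "least_closed =
     Assign Vk 0 ;;
     For Vq Vn2 (If_Le Vq Vk (Get Vr Reach Vq ;; If_Le Vk Vr (Plus Vk Vr Vzero)))"

text \<open>The candidate is complemented back at the odd positions and overwrites the potential.\<close>

definition check :: com where
  "check =
     Assign Vbad 0 ;; Assign Vrow 0 ;; Assign Vp 0 ;;
     For Vi Vm (
       Get Vc Row_Min Vi ;; Get Vt Low_Count Vi ;; If_Le Vt Vk (Shift Vc Vc 1) ;; Plus Vpar Vrow Vzero ;;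
       For Vj Vn (
         Get Vd Potential Vp ;; Minus Vd Vd Vc ;; Get Vt Onset Vj ;; If_Le Vt Vk (Shift Vd Vd 1) ;;
         If_Less Vd Vzero (Assign Vbad 1) ;; If_Less Vone Vd (Assign Vbad 1) ;;
         If_Less Vzero Vpar (Minus Vd Vone Vd) ;;
         Put Potential Vp Vd ;;
         Minus Vpar Vone Vpar ;; Shift Vp Vp 1) ;;
       Minus Vrow Vone Vrow)"

definition answer :: com where
  "answer =
     If_Less Vzero Vbad (Output Vzero) ;;
     If_Le Vbad Vzero (
       Output Vone ;; Assign Vp 0 ;;
       For Vi Vm (For Vj Vn (Get Vd Potential Vp ;; Output Vd ;; Shift Vp Vp 1)))"

definition solver :: com where
  "solver = read_size ;; build_potential ;; compute_rows ;; compute_onset ;; compute_reach ;;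
     least_closed ;; check ;; answer"

text \<open>The limits \<open>m - 1\<close> and \<open>n - 1\<close> are rounded up, which makes the time bound a polynomial without
truncated subtraction. The variables that are not mentioned and differ from \<open>Vn\<close> and \<open>Vn1\<close> never limit a loop.\<close>

definition loop_bound :: "nat \<Rightarrow> nat \<Rightarrow> var \<Rightarrow> nat" where
  "loop_bound m n v = (if v = Vm \<or> v = Vm1 then m else if v = Vn2 then n + 1 else n)"

lemma loop_bound_simps [simp]:
  "loop_bound m n Vm = m" "loop_bound m n Vm1 = m" "loop_bound m n Vn = n" "loop_bound m n Vn1 = n" "loop_bound m n Vn2 = n + 1"
  by (simp_all add: loop_bound_def)

lemma time_bound_solver: "time_bound (loop_bound m n) solver = 176 * (m * n) + 74 * m + 28 * n + 48"
  unfolding solver_def read_size_def build_potential_def compute_rows_def compute_onset_def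
    compute_reach_def least_closed_def check_def answer_def
  by (simp add: algebra_simps)

lemmas wp_atomic = wp.simps(1-11)

section \<open>Correctness of the passes\<close>

text \<open>An opaque constant for the content of the parity variables, so that simplification does not split
cases on the parity before a sign is actually chosen.\<close>

definition parity :: "nat \<Rightarrow> int" where
  "parity x = int (x mod 2)"

lemma parity_simps [simp]:
  "parity 0 = 0" "1 - parity x = parity (Suc x)" "0 < parity x \<longleftrightarrow> odd x"
  by (simp_all add: parity_def) presburger+

locale instance22 =
  fixes m n :: nat and s :: "nat \<Rightarrow> nat \<Rightarrow> int"
  assumes size: "2 \<le> m" "2 \<le> n"

sublocale instance22 \<subseteq> threshold m n "potential s"
  using size by unfold_locales auto

context instance22
begin

abbreviation C :: "nat \<Rightarrow> nat \<Rightarrow> int" where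
  "C \<equiv> potential s"

text \<open>The array index of a matrix entry. It stays folded during simplification, because \<open>nat (int (idx i j))\<close>
simplifies while the corresponding polynomial expression does not.\<close>

definition idx :: "nat \<Rightarrow> nat \<Rightarrow> nat" where
  "idx i j = i * n + j"

lemma idx_0 [simp]: "idx 0 0 = 0"
  by (simp add: idx_def)

lemma idx_row_end: "idx i n = idx (Suc i) 0"
  by (simp add: idx_def)

lemma idx_Suc: "idx i (Suc j) = Suc (idx i j)"
  by (simp add: idx_def)

lemma int_idx_steps [simp]:
  "int (idx (Suc i) j) - int n = int (idx i j)"
  "int (idx i j) + int n = int (idx (Suc i) j)"
  "int (idx i j) + 1 = int (idx i (Suc j))"
  "1 + int (idx i j) = int (idx i (Suc j))"
  by (simp_all add: idx_def)

lemma idx_eq_iff: "j < n \<Longrightarrow> j' < n \<Longrightarrow> idx i j = idx i' j' \<longleftrightarrow> i = i' \<and> j = j'"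
proof
  assume "j < n" "j' < n" "idx i j = idx i' j'"
  then have "idx i j div n = idx i' j' div n" "idx i j mod n = idx i' j' mod n"
    by simp_all
  then show "i = i' \<and> j = j'"
    using \<open>j < n\<close> \<open>j' < n\<close> by (simp add: idx_def)
qed simp

lemma idx_less: "i < m \<Longrightarrow> j < n \<Longrightarrow> idx i j < idx m 0"
proof -
  assume "i < m" "j < n"
  then have "idx i j < Suc i * n"
    by (simp add: idx_def)
  also have "\<dots> \<le> m * n"
    using \<open>i < m\<close> by (intro mult_right_mono) auto
  finally show ?thesis
    by (simp add: idx_def)
qed

definition stored :: "(nat \<Rightarrow> int) \<Rightarrow> (nat \<Rightarrow> nat \<Rightarrow> int) \<Rightarrow> bool" where
  "stored f F \<longleftrightarrow> (\<forall>i<m. \<forall>j<n. f (idx i j) = F i j)"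

text \<open>Invariant of a pass that overwrites a matrix in row-major order: the entries before position
\<open>p\<close> are those of \<open>F\<close>, the others those of \<open>G\<close>.\<close>

definition mixed :: "nat \<Rightarrow> (nat \<Rightarrow> nat \<Rightarrow> int) \<Rightarrow> (nat \<Rightarrow> nat \<Rightarrow> int) \<Rightarrow> nat \<Rightarrow> nat \<Rightarrow> int" where
  "mixed p F G i j = (if idx i j < p then F i j else G i j)"

lemma stored_lookup: "stored f F \<Longrightarrow> i < m \<Longrightarrow> j < n \<Longrightarrow> f (idx i j) = F i j"
  by (simp add: stored_def)

lemma mixed_0 [simp]: "mixed 0 F G = G"
  by (simp add: fun_eq_iff mixed_def)

lemma stored_mixed_end: "stored f (mixed (idx m 0) F G) \<longleftrightarrow> stored f F"
  by (auto simp: stored_def mixed_def idx_less)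

lemma stored_update:
  assumes "stored f (mixed (idx i j) F G)" "j < n"
  shows "stored (f(idx i j := F i j)) (mixed (Suc (idx i j)) F G)"
  using assms by (auto simp: stored_def mixed_def idx_eq_iff less_Suc_eq)

lemma stored_skip:
  assumes "stored f (mixed (idx i j) F G)" "j < n" "F i j = G i j"
  shows "stored f (mixed (Suc (idx i j)) F G)"
  using assms by (auto simp: stored_def mixed_def idx_eq_iff less_Suc_eq)

definition all_before :: "nat \<Rightarrow> (nat \<Rightarrow> nat \<Rightarrow> bool) \<Rightarrow> bool" where
  "all_before p P \<longleftrightarrow> (\<forall>i<m. \<forall>j<n. idx i j < p \<longrightarrow> P i j)"

lemma all_before_0 [simp]: "all_before 0 P"
  by (simp add: all_before_def)

lemma all_before_Suc:
  "i < m \<Longrightarrow> j < n \<Longrightarrow> all_before (Suc (idx i j)) P \<longleftrightarrow> all_before (idx i j) P \<and> P i j"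
  by (auto simp: all_before_def less_Suc_eq idx_eq_iff)

lemma all_before_end: "all_before (idx m 0) P \<longleftrightarrow> (\<forall>i<m. \<forall>j<n. P i j)"
  by (auto simp: all_before_def idx_less)

definition header :: "(var \<Rightarrow> int) \<Rightarrow> bool" where
  "header V \<longleftrightarrow> V Vm = int m \<and> V Vn = int n \<and> V Vm1 = int (m - 1) \<and> V Vn1 = int (n - 1) \<and>
     V Vn2 = int (n + 1) \<and> V Vzero = 0 \<and> V Vone = 1"

definition input_from :: "nat \<Rightarrow> nat \<Rightarrow> int list" where
  "input_from i j = map (s i) [j..<n - 1] @ concat (map (\<lambda>i. map (s i) [0..<n - 1]) [Suc i..<m - 1])"

definition rows_input :: "nat \<Rightarrow> int list" where
  "rows_input i = concat (map (\<lambda>i. map (s i) [0..<n - 1]) [i..<m - 1])"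

lemma rows_input_eq: "i < m - 1 \<Longrightarrow> rows_input i = input_from i 0"
  by (simp add: rows_input_def input_from_def upt_conv_Cons)

lemma input_from_end: "input_from i (n - 1) = rows_input (Suc i)"
  by (simp add: rows_input_def input_from_def)

lemma input_from_Cons: "j < n - 1 \<Longrightarrow> input_from i j = s i j # input_from i (Suc j)"
  by (simp add: input_from_def upt_conv_Cons)

lemma wp_read_size:
  "wp bd read_size (\<lambda>V M xs ys. header V \<and> M = (\<lambda>_ _. 0) \<and> xs = xs0 \<and> ys = [])
     (\<lambda>_. 0) (\<lambda>_ _. 0) (int m # int n # xs0) []"
  using size by (simp add: read_size_def header_def)

definition potential_done :: assertion where
  "potential_done V M xs ys \<longleftrightarrow> header V \<and> stored (M Potential) C \<and> M Reach = (\<lambda>_. 0) \<and> ys = []"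

lemma wp_build_potential:
  assumes "header V" "M = (\<lambda>_ _. 0)"
  shows "wp (loop_bound m n) build_potential potential_done V M (rows_input 0) []"
  unfolding build_potential_def wp_atomic
proof (rule wp_For[where N = "m - 1" and I = "\<lambda>i V M xs ys. header V \<and> V Vrow = parity i \<and>
    V Vp = int (idx (Suc i) 0) \<and> stored (M Potential) (mixed (idx (Suc i) 0) C (\<lambda>_ _. 0)) \<and>
    M Reach = (\<lambda>_. 0) \<and> xs = rows_input i \<and> ys = []"], goal_cases)
  case (6 i V M xs ys)
  note outer = 6
  have skip: "stored (M Potential) (mixed (idx (Suc i) (Suc 0)) C (\<lambda>_ _. 0))"
    unfolding idx_Suc by (rule stored_skip) (use outer size in auto)
  show ?case
    unfolding wp_atomic
  proof (rule wp_For[where N = "n - 1" and I = "\<lambda>j V M xs ys. header V \<and> V Vi = int i \<and>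
      V Vrow = parity i \<and> V Vpar = parity (i + j) \<and> V Vg = (\<Sum>b<j. mixed_diff s i b) \<and>
      V Vp = int (idx (Suc i) (Suc j)) \<and>
      stored (M Potential) (mixed (idx (Suc i) (Suc j)) C (\<lambda>_ _. 0)) \<and>
      M Reach = (\<lambda>_. 0) \<and> xs = input_from i j \<and> ys = []"], goal_cases)
    case (6 j V M xs ys)
    then have ij: "Suc i < m" "Suc j < n" "i < m"
      using outer(1) by auto
    have "M Potential (idx i (Suc j)) = C i (Suc j)"
      using 6 ij stored_lookup[of "M Potential" "mixed (idx (Suc i) (Suc j)) C (\<lambda>_ _. 0)" i "Suc j"] size
      by (simp add: mixed_def idx_def)
    moreover have "stored ((M Potential)(idx (Suc i) (Suc j) := C (Suc i) (Suc j)))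
        (mixed (idx (Suc i) (Suc (Suc j))) C (\<lambda>_ _. 0))"
      unfolding idx_Suc[of _ "Suc j"] by (rule stored_update) (use 6 ij in auto)
    moreover have "xs = s i j # input_from i (Suc j)"
      using 6 input_from_Cons by simp
    moreover have "C (Suc i) (Suc j) = C i (Suc j) + ((\<Sum>b<j. mixed_diff s i b) + mixed_diff s i j)"
      by (simp add: potential_Suc)
    moreover have "mixed_diff s i j = (if even (i + j) then s i j - 2 else - (s i j - 2))"
      by (simp add: mixed_diff_def)
    ultimately show ?case
      using 6 ij
      by (simp add: header_def split: if_splits)
  next
    case 5
    then show ?case
      using outer skip by (simp add: header_def rows_input_eq)
  next
    case (7 V M xs ys)
    then show ?case
      using outer(1) size by (auto simp add: header_def input_from_end[simplified] idx_row_end)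
  qed (use outer size in \<open>auto simp: header_def\<close>)
next
  case 5
  have "C i j = 0" if "idx i j < idx (Suc 0) 0" for i j
    using that by (cases i) (auto simp: idx_def)
  then have "stored (\<lambda>_. 0) (mixed (idx (Suc 0) 0) C (\<lambda>_ _. 0))"
    by (simp add: stored_def mixed_def)
  then show ?case
    using assms by (simp add: header_def idx_def)
next
  case (7 V M xs ys)
  then show ?case
    using size by (simp add: potential_done_def stored_mixed_end)
qed (use assms size in \<open>auto simp: header_def\<close>)

text \<open>The values of the working variables after a part of a column or row, in the form in which the loops
update them.\<close>

fun prefix_onset :: "nat \<Rightarrow> nat \<Rightarrow> nat" where
  "prefix_onset 0 j = n"
| "prefix_onset (Suc i) j = (if C i j \<le> row_min i \<and> low_count i \<le> prefix_onset i j then low_count i else prefix_onset i j)"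

lemma prefix_onset_le_iff:
  "j < n \<Longrightarrow> prefix_onset i j \<le> k \<longleftrightarrow> n \<le> k \<or> (\<exists>i'<i. C i' j = row_min i' \<and> low_count i' \<le> k)"
proof (induction i)
  case (Suc i)
  have "C i j \<le> row_min i \<longleftrightarrow> C i j = row_min i"
    using row_min_le[OF Suc.prems, of i] by auto
  with Suc show ?case
    by (auto simp: less_Suc_eq)
qed simp

lemma prefix_onset_end: "j < n \<Longrightarrow> prefix_onset m j = onset j"
  using prefix_onset_le_iff[of j m] onset_le_iff[of j] by (metis order_antisym order_refl)

text \<open>The loop starts with the value 0, which does not affect the minimum of a full row because column 0 of
the potential is 0.\<close>

definition prefix_min :: "nat \<Rightarrow> nat \<Rightarrow> int" where
  "prefix_min i j = Min (insert 0 (C i ` {..<j}))"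

definition prefix_count :: "nat \<Rightarrow> nat \<Rightarrow> nat" where
  "prefix_count i j = card {j'. j' < j \<and> C i j' = prefix_min i j}"

lemma prefix_min_0 [simp]: "prefix_min i 0 = 0"
  by (simp add: prefix_min_def)

lemma prefix_count_0 [simp]: "prefix_count i 0 = 0"
  by (simp add: prefix_count_def)

lemma prefix_min_Suc: "prefix_min i (Suc j) = min (C i j) (prefix_min i j)"
  unfolding prefix_min_def lessThan_Suc image_insert
  by (subst insert_commute, subst Min_insert) auto

lemma prefix_min_le: "j' < j \<Longrightarrow> prefix_min i j \<le> C i j'"
  unfolding prefix_min_def by (intro Min_le) auto

lemma prefix_count_Suc:
  "prefix_count i (Suc j) =
     (if C i j < prefix_min i j then 1
      else if C i j = prefix_min i j then Suc (prefix_count i j) else prefix_count i j)"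
proof -
  consider "C i j < prefix_min i j" | "C i j = prefix_min i j" | "C i j > prefix_min i j"
    by linarith
  then show ?thesis
  proof cases
    case 1
    then have "{j'. j' < Suc j \<and> C i j' = prefix_min i (Suc j)} = {j}"
      using prefix_min_le[of _ j i] by (force simp: prefix_min_Suc less_Suc_eq)
    with 1 show ?thesis
      by (simp add: prefix_count_def)
  next
    case 2
    then have "{j'. j' < Suc j \<and> C i j' = prefix_min i (Suc j)} =
        insert j {j'. j' < j \<and> C i j' = prefix_min i j}"
      by (auto simp: prefix_min_Suc less_Suc_eq)
    with 2 show ?thesis
      by (simp add: prefix_count_def)
  next
    case 3
    then have "{j'. j' < Suc j \<and> C i j' = prefix_min i (Suc j)} =
        {j'. j' < j \<and> C i j' = prefix_min i j}"
      by (auto simp: prefix_min_Suc less_Suc_eq)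
    with 3 show ?thesis
      by (simp add: prefix_count_def)
  qed
qed

lemma prefix_min_end: "prefix_min i n = row_min i"
proof -
  have "insert 0 (C i ` {..<n}) = C i ` {..<n}"
    using size by (intro insert_absorb) (force intro: image_eqI[of _ _ 0])
  then show ?thesis
    by (simp add: prefix_min_def row_min_def)
qed

lemma prefix_count_end: "prefix_count i n = low_count i"
  by (simp add: prefix_count_def low_count_def prefix_min_end)

definition rows_stored :: "(arr \<Rightarrow> nat \<Rightarrow> int) \<Rightarrow> bool" where
  "rows_stored M \<longleftrightarrow> (\<forall>i<m. M Row_Min i = row_min i \<and> M Low_Count i = int (low_count i))"

definition rows_done :: assertion where
  "rows_done V M xs ys \<longleftrightarrow> header V \<and> stored (M Potential) C \<and> rows_stored M \<and>
     M Reach = (\<lambda>_. 0) \<and> ys = []"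

lemma wp_compute_rows:
  assumes "potential_done V M xs ys"
  shows "wp (loop_bound m n) compute_rows rows_done V M xs ys"
  unfolding compute_rows_def wp_atomic
proof (rule wp_For[where N = m and I = "\<lambda>i V M xs ys. header V \<and> V Vp = int (idx i 0) \<and>
    stored (M Potential) C \<and> (\<forall>i'<i. M Row_Min i' = row_min i' \<and> M Low_Count i' = int (low_count i')) \<and>
    M Reach = (\<lambda>_. 0) \<and> ys = []"], goal_cases)
  case (6 i V M xs ys)
  note outer = 6
  show ?case
    unfolding wp_atomic
  proof (rule wp_For[where N = n and I = "\<lambda>j V M xs ys. header V \<and> V Vi = int i \<and>
      V Vp = int (idx i j) \<and> V Vc = prefix_min i j \<and> V Vt = int (prefix_count i j) \<and>
      stored (M Potential) C \<and> (\<forall>i'<i. M Row_Min i' = row_min i' \<and> M Low_Count i' = int (low_count i')) \<and>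
      M Reach = (\<lambda>_. 0) \<and> ys = []"], goal_cases)
    case (6 j V M xs ys)
    moreover have "M Potential (idx i j) = C i j"
      using 6 outer by (auto intro: stored_lookup)
    ultimately show ?case
      by (simp add: header_def prefix_min_Suc prefix_count_Suc)
  next
    case (7 V M xs ys)
    then show ?case
      by (auto simp: header_def prefix_min_end prefix_count_end idx_row_end less_Suc_eq)
  qed (use outer size in \<open>auto simp: header_def\<close>)
qed (use assms size in \<open>auto simp: potential_done_def rows_done_def rows_stored_def header_def\<close>)

definition onset_stored :: "(arr \<Rightarrow> nat \<Rightarrow> int) \<Rightarrow> bool" where
  "onset_stored M \<longleftrightarrow> (\<forall>j<n. M Onset j = int (onset j))"

definition onset_done :: assertion where
  "onset_done V M xs ys \<longleftrightarrow> header V \<and> stored (M Potential) C \<and> rows_stored M \<and> onset_stored M \<and>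
     M Reach = (\<lambda>_. 0) \<and> ys = []"

lemma wp_compute_onset:
  assumes "rows_done V M xs ys"
  shows "wp (loop_bound m n) compute_onset onset_done V M xs ys"
  unfolding compute_onset_def
proof (rule wp_For[where N = n and I = "\<lambda>j V M xs ys. header V \<and> stored (M Potential) C \<and>
    rows_stored M \<and> (\<forall>j'<j. M Onset j' = int (onset j')) \<and> M Reach = (\<lambda>_. 0) \<and> ys = []"], goal_cases)
  case (6 j V M xs ys)
  note outer = 6
  show ?case
    unfolding wp_atomic
  proof (rule wp_For[where N = m and I = "\<lambda>i V M xs ys. header V \<and> V Vj = int j \<and>
      V Vp = int (idx i j) \<and> V Vq = int (prefix_onset i j) \<and> stored (M Potential) C \<and>
      rows_stored M \<and> (\<forall>j'<j. M Onset j' = int (onset j')) \<and> M Reach = (\<lambda>_. 0) \<and> ys = []"], goal_cases)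
    case (6 i V M xs ys)
    moreover have "M Potential (idx i j) = C i j" "M Row_Min i = row_min i" "M Low_Count i = int (low_count i)"
      using 6 outer by (auto intro: stored_lookup simp: rows_stored_def)
    ultimately show ?case
      by (simp add: header_def)
  next
    case (7 V M xs ys)
    then show ?case
      using outer(1) by (auto simp: header_def prefix_onset_end rows_stored_def less_Suc_eq)
  qed (use outer size in \<open>auto simp: header_def idx_def\<close>)
qed (use assms size in \<open>auto simp: rows_done_def onset_done_def onset_stored_def header_def\<close>)

definition demand :: "nat \<Rightarrow> nat \<Rightarrow> nat \<Rightarrow> bool" where
  "demand k i j \<longleftrightarrow> (C i j = row_min i + 1 \<and> onset j \<le> k \<or> row_min i + 2 \<le> C i j \<longrightarrow> low_count i \<le> k)"

lemma closed_at_iff_demand: "closed_at k \<longleftrightarrow> all_before (idx m 0) (demand k)"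
  unfolding closed_at_def all_before_end demand_def ..

text \<open>What the array \<open>Reach\<close> is for: a number \<open>k\<close> respects the entries of the array up to index \<open>k\<close> if and only if
it meets the demands of all matrix entries scanned so far.\<close>

definition reaches :: "nat \<Rightarrow> (nat \<Rightarrow> int) \<Rightarrow> bool" where
  "reaches p R \<longleftrightarrow> (\<forall>k. (\<forall>q\<le>k. R q \<le> int k) \<longleftrightarrow> all_before p (demand k))"

lemma reaches_0: "reaches 0 (\<lambda>_. 0)"
  by (simp add: reaches_def)

lemma reaches_Suc:
  assumes "reaches (idx i j) R" "i < m" "j < n"
    and "\<And>k. (\<forall>q\<le>k. R' q \<le> int k) \<longleftrightarrow> (\<forall>q\<le>k. R q \<le> int k) \<and> demand k i j"
  shows "reaches (idx i (Suc j)) R'"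
  using assms by (simp add: reaches_def idx_Suc all_before_Suc)

text \<open>Raising a single entry adds exactly one conditional lower bound.\<close>

lemma raise_bound:
  fixes R :: "nat \<Rightarrow> int"
  shows "(\<forall>q\<le>k. (if R p \<le> t then R(p := t) else R) q \<le> int k) \<longleftrightarrow>
    (\<forall>q\<le>k. R q \<le> int k) \<and> (p \<le> k \<longrightarrow> t \<le> int k)"
proof (cases "R p \<le> t")
  case True
  have "(\<forall>q\<le>k. (R(p := t)) q \<le> int k) \<longleftrightarrow> (\<forall>q\<le>k. q \<noteq> p \<longrightarrow> R q \<le> int k) \<and> (p \<le> k \<longrightarrow> t \<le> int k)"
    by auto
  moreover have "R p \<le> int k" if "t \<le> int k"
    using True that by simp
  ultimately show ?thesis
    using True by auto
next
  case False
  then have "t \<le> int k" if "R p \<le> int k"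
    using that by simp
  with False show ?thesis
    by auto
qed

definition reach_done :: assertion where
  "reach_done V M xs ys \<longleftrightarrow> header V \<and> stored (M Potential) C \<and> rows_stored M \<and> onset_stored M \<and>
     (\<forall>k. (\<forall>q\<le>k. M Reach q \<le> int k) \<longleftrightarrow> closed_at k) \<and> ys = []"

lemma wp_compute_reach:
  assumes "onset_done V M xs ys"
  shows "wp (loop_bound m n) compute_reach reach_done V M xs ys"
  unfolding compute_reach_def wp_atomic
proof (rule wp_For[where N = m and I = "\<lambda>i V M xs ys. header V \<and> V Vp = int (idx i 0) \<and>
    stored (M Potential) C \<and> rows_stored M \<and> onset_stored M \<and> reaches (idx i 0) (M Reach) \<and> ys = []"], goal_cases)
  case (6 i V M xs ys)
  note outer = 6
  have row: "M Row_Min i = row_min i" "M Low_Count i = int (low_count i)"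
    using outer by (auto simp: rows_stored_def)
  have start: "V Vi = int i"
    using outer by simp
  have loop: "wp (loop_bound m n) (For Vj Vn (
         Get Vd Potential Vp ;; Minus Vd Vd Vc ;;
         If_Le Vone Vd (
           Assign Vq 0 ;; If_Le Vd Vone (Get Vq Onset Vj) ;;
           Get Vr Reach Vq ;; If_Le Vr Vt (Put Reach Vq Vt)) ;;
         Shift Vp Vp 1)) (\<lambda>V M xs ys. V Vi = int i \<and> V Vm = int m \<and> header V \<and> V Vp = int (idx (Suc i) 0) \<and>
      stored (M Potential) C \<and> rows_stored M \<and> onset_stored M \<and> reaches (idx (Suc i) 0) (M Reach) \<and> ys = [])
      (V(Vc := row_min i, Vt := int (low_count i))) M xs ys"
  proof (rule wp_For[where N = n and I = "\<lambda>j V M xs ys. header V \<and> V Vi = int i \<and>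
      V Vp = int (idx i j) \<and> V Vc = row_min i \<and> V Vt = int (low_count i) \<and>
      stored (M Potential) C \<and> rows_stored M \<and> onset_stored M \<and> reaches (idx i j) (M Reach) \<and> ys = []"], goal_cases)
    case (6 j V M xs ys)
    let ?R = "M Reach"
    let ?raise = "\<lambda>q. if ?R q \<le> int (low_count i) then ?R(q := int (low_count i)) else ?R"
    have look: "M Potential (idx i j) = C i j" "M Onset j = int (onset j)"
      using 6 outer by (auto intro: stored_lookup simp: onset_stored_def)
    have ij: "i < m" "j < n" "reaches (idx i j) ?R"
      using 6 outer by auto
    note step = reaches_Suc[OF ij(3,1,2)]
    consider "C i j = row_min i" | "C i j = row_min i + 1" | "row_min i + 2 \<le> C i j"
      using row_min_le[OF ij(2), of i] by linarith
    then show ?case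
    proof cases
      case 1
      have "reaches (idx i (Suc j)) ?R"
        by (rule step) (use 1 in \<open>simp add: demand_def\<close>)
      with 1 6 look show ?thesis
        by (simp add: header_def)
    next
      case 2
      have "reaches (idx i (Suc j)) (?raise (onset j))"
        by (rule step) (use 2 in \<open>simp add: raise_bound demand_def\<close>)
      with 2 6 look show ?thesis
        by (cases "?R (onset j) \<le> int (low_count i)") (simp_all add: header_def rows_stored_def onset_stored_def)
    next
      case 3
      have "reaches (idx i (Suc j)) (?raise 0)"
        by (rule step) (use 3 in \<open>simp add: raise_bound demand_def\<close>)
      with 3 6 look show ?thesis
        by (cases "?R 0 \<le> int (low_count i)") (simp_all add: header_def rows_stored_def onset_stored_def)
    qed
  next
    case (7 V M xs ys)
    then show ?case
      by (auto simp: header_def idx_row_end)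
  qed (use outer size in \<open>auto simp: header_def\<close>)
  show ?case
    unfolding wp_atomic using start row
    by (auto intro!: wp_mono[OF loop] simp: header_def simp del: wp.simps(12))
next
  case (7 V M xs ys)
  then show ?case
    by (simp add: reach_done_def reaches_def closed_at_iff_demand)
qed (use assms size in \<open>auto simp: onset_done_def header_def reaches_0\<close>)

definition least_done :: "nat \<Rightarrow> assertion" where
  "least_done k V M xs ys \<longleftrightarrow> header V \<and> V Vk = int k \<and> stored (M Potential) C \<and> rows_stored M \<and> onset_stored M \<and> ys = []"

lemma wp_least_closed:
  assumes "reach_done V M xs ys"
  shows "wp (loop_bound m n) least_closed (\<lambda>V M xs ys. \<exists>k. closed_at k \<and> (\<forall>k'. closed_at k' \<longrightarrow> k \<le> k') \<and>
    least_done k V M xs ys) V M xs ys"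
  unfolding least_closed_def wp_atomic
proof (rule wp_For[where N = "n + 1" and I = "\<lambda>q V M xs ys. reach_done V M xs ys \<and>
    (\<exists>k. V Vk = int k \<and> (\<forall>k'. closed_at k' \<longrightarrow> k \<le> k') \<and> (\<forall>q'<q. q' \<le> k \<longrightarrow> M Reach q' \<le> int k))"], goal_cases)
  case (6 q V M xs ys)
  then obtain k where k: "V Vk = int k" "\<And>k'. closed_at k' \<Longrightarrow> k \<le> k'"
    "\<And>q'. q' < q \<Longrightarrow> q' \<le> k \<Longrightarrow> M Reach q' \<le> int k"
    by blast
  have reach: "reach_done V M xs ys" and closed_at: "\<And>k q. closed_at k \<Longrightarrow> q \<le> k \<Longrightarrow> M Reach q \<le> int k"
    using 6 by (auto simp: reach_done_def)
  \<comment> \<open>The value of the variable after round \<open>q\<close>.\<close>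
  define k1 where "k1 = (if q \<le> k \<and> int k \<le> M Reach q then nat (M Reach q) else k)"
  have "k1 \<le> k'" if "closed_at k'" for k'
    using k(2)[OF that] closed_at[OF that, of q] by (auto simp: k1_def)
  moreover have "M Reach q' \<le> int k1" if "q' < Suc q" "q' \<le> k1" for q'
    using that k(3)[of q'] by (cases "q' = q") (auto simp: k1_def split: if_splits)
  ultimately have ex: "\<exists>k. int k1 = int k \<and> (\<forall>k'. closed_at k' \<longrightarrow> k \<le> k') \<and>
      (\<forall>q'<Suc q. q' \<le> k \<longrightarrow> M Reach q' \<le> int k)"
    by (intro exI[of _ k1]) auto
  show ?case
  proof (cases "q \<le> k \<and> int k \<le> M Reach q")
    case True
    with ex have "\<exists>k. M Reach q = int k \<and> (\<forall>k'. closed_at k' \<longrightarrow> k \<le> k') \<and>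
        (\<forall>q'<Suc q. q' \<le> k \<longrightarrow> M Reach q' \<le> int k)"
      by (simp only: k1_def if_True) auto
    with True 6(1-3) k(1) reach show ?thesis
      by (simp add: reach_done_def header_def)
  next
    case False
    with ex have "\<exists>k'. int k = int k' \<and> (\<forall>k''. closed_at k'' \<longrightarrow> k' \<le> k'') \<and>
        (\<forall>q'<Suc q. q' \<le> k' \<longrightarrow> M Reach q' \<le> int k')"
      by (simp only: k1_def if_False)
    with False 6(1-3) k(1) reach show ?thesis
      by (auto simp: reach_done_def header_def)
  qed
next
  case (7 V M xs ys)
  then obtain k where k: "V Vk = int k" "\<And>k'. closed_at k' \<Longrightarrow> k \<le> k'"
    "\<And>q'. q' < n + 1 \<Longrightarrow> q' \<le> k \<Longrightarrow> M Reach q' \<le> int k"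
    by auto
  have "k \<le> n"
    by (rule k(2)[OF closed_at_n])
  with k(3) have "\<forall>q\<le>k. M Reach q \<le> int k"
    by auto
  then have "closed_at k"
    using 7 by (simp add: reach_done_def)
  with k 7 show ?case
    by (auto simp: reach_done_def least_done_def intro!: exI[of _ k])
qed (use assms size in \<open>auto simp: reach_done_def header_def\<close>)

definition sol :: "nat \<Rightarrow> nat \<Rightarrow> nat \<Rightarrow> int" where
  "sol k i j = flip i j (candidate k i j)"

definition failed :: "nat \<Rightarrow> nat \<Rightarrow> int" where
  "failed k p = of_bool (\<not> all_before p (\<lambda>i j. candidate k i j \<in> {0, 1}))"

lemma failed_0 [simp]: "failed k 0 = 0"
  by (simp add: failed_def)

lemma failed_Suc:
  assumes "i < m" "j < n"
  shows "failed k (idx i (Suc j)) = (if 0 \<le> candidate k i j \<and> candidate k i j \<le> 1 then failed k (idx i j) else 1)"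
  unfolding failed_def idx_Suc all_before_Suc[OF assms] by auto

lemma failed_end: "failed k (idx m 0) = of_bool (\<not> (\<forall>i<m. \<forall>j<n. candidate k i j \<in> {0, 1}))"
  by (simp add: failed_def all_before_end)

definition checked :: "nat \<Rightarrow> assertion" where
  "checked k V M xs ys \<longleftrightarrow> header V \<and> stored (M Potential) (sol k) \<and>
     V Vbad = of_bool (\<not> (\<forall>i<m. \<forall>j<n. candidate k i j \<in> {0, 1})) \<and> ys = []"

lemma wp_check:
  assumes "least_done k V M xs ys"
  shows "wp (loop_bound m n) check (checked k) V M xs ys"
  unfolding check_def wp_atomic
proof (rule wp_For[where N = m and I = "\<lambda>i V M xs ys. header V \<and> V Vk = int k \<and>
    V Vp = int (idx i 0) \<and> V Vrow = parity i \<and>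
    V Vbad = failed k (idx i 0) \<and>
    stored (M Potential) (mixed (idx i 0) (sol k) C) \<and> rows_stored M \<and> onset_stored M \<and> ys = []"], goal_cases)
  case (6 i V M xs ys)
  note outer = 6
  have row: "M Row_Min i = row_min i" "M Low_Count i = int (low_count i)"
    using outer by (auto simp: rows_stored_def)
  have start: "V Vi = int i" "V Vk = int k" "header V" "V Vp = int (idx i 0)" "V Vrow = parity i"
    "V Vbad = failed k (idx i 0)"
    using outer by simp_all
  define c where "c = row_min i + of_bool (low_count i \<le> k)"
  have loop: "wp (loop_bound m n) (For Vj Vn (
         Get Vd Potential Vp ;; Minus Vd Vd Vc ;; Get Vt Onset Vj ;; If_Le Vt Vk (Shift Vd Vd 1) ;;
         If_Less Vd Vzero (Assign Vbad 1) ;; If_Less Vone Vd (Assign Vbad 1) ;;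
         If_Less Vzero Vpar (Minus Vd Vone Vd) ;;
         Put Potential Vp Vd ;;
         Minus Vpar Vone Vpar ;; Shift Vp Vp 1)) (\<lambda>V M xs ys. V Vi = int i \<and> header V \<and> V Vk = int k \<and>
    V Vp = int (idx (Suc i) 0) \<and> V Vrow = parity i \<and>
    V Vbad = failed k (idx (Suc i) 0) \<and>
    stored (M Potential) (mixed (idx (Suc i) 0) (sol k) C) \<and> rows_stored M \<and> onset_stored M \<and> ys = [])
    V' M xs ys"
    if "header V'" "V' Vi = int i" "V' Vk = int k" "V' Vp = int (idx i 0)" "V' Vrow = parity i"
      "V' Vbad = failed k (idx i 0)"
      "V' Vpar = parity i" "V' Vc = c" for V'
  proof (rule wp_For[where N = n and I = "\<lambda>j V M xs ys. header V \<and> V Vi = int i \<and> V Vk = int k \<and>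
      V Vp = int (idx i j) \<and> V Vrow = parity i \<and> V Vpar = parity (i + j) \<and> V Vc = c \<and>
      V Vbad = failed k (idx i j) \<and>
      stored (M Potential) (mixed (idx i j) (sol k) C) \<and> rows_stored M \<and> onset_stored M \<and> ys = []"], goal_cases)
    case (6 j V M xs ys)
    have ij: "i < m" "j < n"
      using 6 outer by auto
    have look: "M Potential (idx i j) = C i j" "M Onset j = int (onset j)"
      using 6 ij stored_lookup[of "M Potential" "mixed (idx i j) (sol k) C" i j]
      by (auto simp: onset_stored_def mixed_def)
    have "stored ((M Potential)(idx i j := sol k i j)) (mixed (idx i (Suc j)) (sol k) C)"
      unfolding idx_Suc by (rule stored_update) (use 6 ij in auto)
    moreover have "sol k i j = (if even (i + j) then candidate k i j else 1 - candidate k i j)"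
      by (simp add: sol_def flip_def)
    moreover have "candidate k i j = (if onset j \<le> k then C i j - c + 1 else C i j - c)"
      by (simp add: candidate_def c_def)
    moreover have "failed k (idx i (Suc j)) = (if 0 \<le> candidate k i j \<and> candidate k i j \<le> 1 then failed k (idx i j) else 1)"
      using ij by (rule failed_Suc)
    ultimately show ?case
      using 6 look
      by (cases "onset j \<le> k"; cases "even (i + j)"; cases "candidate k i j < 0"; cases "1 < candidate k i j")
        (simp_all add: header_def onset_stored_def rows_stored_def)
  next
    case (7 V M xs ys)
    then show ?case
      by (auto simp: header_def idx_row_end)
  qed (use that outer size in \<open>auto simp: header_def\<close>)
  show ?case
    unfolding wp_atomic using start row
    by (auto intro!: wp_mono[OF loop] simp: header_def c_def simp del: wp.simps(12))
next
  case (7 V M xs ys)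
  then show ?case
    by (simp add: checked_def stored_mixed_end failed_end)
qed (use assms size in \<open>auto simp: least_done_def header_def\<close>)

definition printed :: "nat \<Rightarrow> nat \<Rightarrow> nat \<Rightarrow> int list" where
  "printed k i j = 1 # concat (map (\<lambda>i. map (sol k i) [0..<n]) [0..<i]) @ map (sol k i) [0..<j]"

lemma printed_simps [simp]:
  "printed k 0 0 = [1]" "printed k i n = printed k (Suc i) 0"
  "printed k i (Suc j) = printed k i j @ [sol k i j]"
  by (simp_all add: printed_def)

lemma wp_answer:
  assumes "checked k V M xs ys"
  shows "wp (loop_bound m n) answer (\<lambda>V M xs ys.
    ys = (if \<forall>i<m. \<forall>j<n. candidate k i j \<in> {0, 1} then printed k m 0 else [0])) V M xs ys"
proof (cases "\<forall>i<m. \<forall>j<n. candidate k i j \<in> {0, 1}")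
  case False
  with assms show ?thesis
    by (auto simp: answer_def checked_def header_def)
next
  case True
  have "wp (loop_bound m n) (For Vi Vm (For Vj Vn (Get Vd Potential Vp ;; Output Vd ;; Shift Vp Vp 1)))
      (\<lambda>V M xs ys. ys = printed k m 0) (V(Vp := 0)) M xs [1]"
  proof (rule wp_For[where N = m and I = "\<lambda>i V M xs ys. header V \<and> V Vp = int (idx i 0) \<and>
      stored (M Potential) (sol k) \<and> ys = printed k i 0"], goal_cases)
    case (6 i V M xs ys)
    note outer = 6
    show ?case
    proof (rule wp_For[where N = n and I = "\<lambda>j V M xs ys. header V \<and> V Vi = int i \<and>
        V Vp = int (idx i j) \<and> stored (M Potential) (sol k) \<and> ys = printed k i j"], goal_cases)
      case (6 j V M xs ys)
      moreover have "M Potential (idx i j) = sol k i j"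
        using 6 outer by (auto intro: stored_lookup)
      ultimately show ?case
        by (simp add: header_def)
    next
      case (7 V M xs ys)
      then show ?case
        by (auto simp: header_def idx_row_end)
    qed (use outer size in \<open>auto simp: header_def\<close>)
  qed (use assms size in \<open>auto simp: checked_def header_def\<close>)
  moreover have "V Vbad = 0" "V Vzero = 0" "V Vone = 1" "ys = []"
    using assms True by (auto simp: checked_def header_def)
  ultimately show ?thesis
    unfolding answer_def if_P[OF True] by (simp del: wp.simps(12))
qed

text \<open>The passes in sequence: each postcondition is the precondition of the next pass.\<close>

theorem wp_solver:
  "wp (loop_bound m n) solver (\<lambda>V M xs ys. \<exists>k. closed_at k \<and> (\<forall>k'. closed_at k' \<longrightarrow> k \<le> k') \<and>
      ys = (if \<forall>i<m. \<forall>j<n. candidate k i j \<in> {0, 1} then printed k m 0 else [0]))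
    (\<lambda>_. 0) (\<lambda>_ _. 0) (int m # int n # rows_input 0) []"
  unfolding solver_def wp.simps(9)
proof (rule wp_mono[OF wp_read_size], goal_cases)
  case (1 V M xs ys)
  then have "wp (loop_bound m n) build_potential potential_done V M xs ys"
    using wp_build_potential by blast
  then show ?case
  proof (rule wp_mono, goal_cases)
    case (1 V M xs ys)
    then show ?case
    proof (rule wp_mono[OF wp_compute_rows], goal_cases)
      case (1 V M xs ys)
      then show ?case
      proof (rule wp_mono[OF wp_compute_onset], goal_cases)
        case (1 V M xs ys)
        then show ?case
        proof (rule wp_mono[OF wp_compute_reach], goal_cases)
          case (1 V M xs ys)
          then show ?case
          proof (rule wp_mono[OF wp_least_closed], goal_cases)
            case (1 V M xs ys)
            then obtain k where k: "closed_at k" "\<forall>k'. closed_at k' \<longrightarrow> k \<le> k'" "least_done k V M xs ys"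
              by blast
            show ?case
            proof (rule wp_mono[OF wp_check[OF k(3)]], goal_cases)
              case (1 V M xs ys)
              show ?case
                by (rule wp_mono[OF wp_answer[OF 1]]) (use k in blast)
            qed
          qed
        qed
      qed
    qed
  qed
qed

end


section \<open>Matrices\<close>

lemma binary_solution_22_iff:
  assumes "2 \<le> m" "2 \<le> n" "S \<in> carrier_mat (m - 1) (n - 1)"
  shows "binary_solution_22 m n S A \<longleftrightarrow> A \<in> carrier_mat m n \<and>
    (\<forall>i<m. \<forall>j<n. A $$ (i, j) \<in> {0, 1}) \<and>
    windows_22 m n (\<lambda>i j. S $$ (i, j)) (\<lambda>i j. A $$ (i, j))"
proof (cases "A \<in> carrier_mat m n")
  case True
  have "elements_mat A \<subseteq> {0, 1} \<longleftrightarrow> (\<forall>i<m. \<forall>j<n. A $$ (i, j) \<in> {0, 1})"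
    using True by (auto dest!: elements_matD intro: elements_matI)
  moreover have "window_sum 2 2 A = S \<longleftrightarrow>
      windows_22 m n (\<lambda>i j. S $$ (i, j)) (\<lambda>i j. A $$ (i, j))"
  proof -
    have dims: "dim_row A + 1 - 2 = m - 1" "dim_col A + 1 - 2 = n - 1"
      using True assms by auto
    have "window_sum 2 2 A = S \<longleftrightarrow>
        (\<forall>i<m - 1. \<forall>j<n - 1. (\<Sum>a<2. \<Sum>b<2. A $$ (i + a, j + b)) = S $$ (i, j))"
      unfolding window_sum_def dims using assms(3) by (auto simp: mat_eq_iff)
    also have "\<dots> \<longleftrightarrow> windows_22 m n (\<lambda>i j. S $$ (i, j)) (\<lambda>i j. A $$ (i, j))"
      unfolding windows_22_def by (simp add: numeral_2_eq_2 less_diff_conv ac_simps)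
    finally show ?thesis .
  qed
  ultimately show ?thesis
    using True by (simp add: binary_solution_22_def)
qed (simp add: binary_solution_22_def)

lemma entries_eq:
  "A \<in> carrier_mat m n \<Longrightarrow> entries A = concat (map (\<lambda>i. map (\<lambda>j. A $$ (i, j)) [0..<n]) [0..<m])"
  by (simp add: entries_def mat_to_list_def)

text \<open>A binary candidate is printed as a solution. If the candidate for the least closed \<open>k\<close> is not
binary, then by \<open>candidate_binary_if_solvable\<close> no solution exists.\<close>

lemma correct_answer_22_least:
  fixes S :: "int mat"
  defines "s \<equiv> \<lambda>i j. S $$ (i, j)"
  assumes "2 \<le> m" "2 \<le> n" "S \<in> carrier_mat (m - 1) (n - 1)"
    and k: "threshold.closed_at m n (potential s) k"
      "\<forall>k'. threshold.closed_at m n (potential s) k' \<longrightarrow> k \<le> k'"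
  shows "correct_answer_22 m n S
    (if \<forall>i<m. \<forall>j<n. threshold.candidate m n (potential s) k i j \<in> {0, 1}
     then instance22.printed m n s k m 0 else [0])"
proof -
  interpret instance22 m n s
    using assms by unfold_locales
  note iff = binary_windows_22_iff_candidate[of m n s k]
  show ?thesis
  proof (cases "\<forall>i<m. \<forall>j<n. candidate k i j \<in> {0, 1}")
    case True
    define A where "A = mat m n (\<lambda>(i, j). sol k i j)"
    have A: "A \<in> carrier_mat m n" and Aij: "\<And>i j. i < m \<Longrightarrow> j < n \<Longrightarrow> A $$ (i, j) = sol k i j"
      by (simp_all add: A_def)
    have "sol k i j \<in> {0, 1}" if "i < m" "j < n" for i j
      using True that unfolding sol_def flip_01 by blast
    moreover have "windows_22 m n s (sol k)"
      using windows_22_candidate[of m n s k] size unfolding sol_def[abs_def] by simp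
    then have "windows_22 m n s (\<lambda>i j. A $$ (i, j))"
      by (auto simp: windows_22_def Aij)
    ultimately have "binary_solution_22 m n S A"
      unfolding binary_solution_22_iff[OF assms(2-4)] using A Aij by (simp add: s_def)
    moreover have "printed k m 0 = 1 # entries A"
      unfolding entries_eq[OF A] printed_def by (auto simp: Aij intro!: arg_cong[of _ _ concat])
    ultimately show ?thesis
      using True by (auto simp: correct_answer_22_def)
  next
    case False
    have "\<not> binary_solution_22 m n S A" for A
    proof
      assume "binary_solution_22 m n S A"
      then have "\<exists>A. (\<forall>i<m. \<forall>j<n. A i j \<in> {0, 1}) \<and> windows_22 m n s A"
        unfolding binary_solution_22_iff[OF assms(2-4)] s_def by (intro exI[of _ "\<lambda>i j. A $$ (i, j)"]) blast
      then show False
        using False iff k size by auto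
    qed
    with False show ?thesis
      by (simp only: correct_answer_22_def if_False) blast
  qed
qed

lemma run_solver:
  assumes "2 \<le> m" "2 \<le> n" "S \<in> carrier_mat (m - 1) (n - 1)"
  obtains t w ys where "run (program solver) (encode_instance m n S) t w ys"
    "correct_answer_22 m n S ys" "t \<le> 327 * (m * n)"
proof -
  define s where "s = (\<lambda>i j. S $$ (i, j))"
  interpret instance22 m n s
    using assms by unfold_locales
  have "rows_input 0 = entries S"
    unfolding entries_eq[OF assms(3)] rows_input_def by (simp add: s_def)
  then have "encode_instance m n S = int m # int n # rows_input 0"
    by (simp add: encode_instance_def)
  with wp_solver have "wp (loop_bound m n) solver (\<lambda>V M xs ys. \<exists>k. closed_at k \<and> (\<forall>k'. closed_at k' \<longrightarrow> k \<le> k') \<and>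
      ys = (if \<forall>i<m. \<forall>j<n. candidate k i j \<in> {0, 1} then printed k m 0 else [0]))
      (\<lambda>_. 0) (\<lambda>_ _. 0) (encode_instance m n S) []"
    by (simp only:)
  then obtain t w V M xs' ys where run: "run (program solver) (encode_instance m n S) t w ys"
    "t \<le> time_bound (loop_bound m n) solver + 1" and "\<exists>k. closed_at k \<and> (\<forall>k'. closed_at k' \<longrightarrow> k \<le> k') \<and>
      ys = (if \<forall>i<m. \<forall>j<n. candidate k i j \<in> {0, 1} then printed k m 0 else [0])"
    by (rule run_program)
  then obtain k where k: "closed_at k" "\<forall>k'. closed_at k' \<longrightarrow> k \<le> k'"
    "ys = (if \<forall>i<m. \<forall>j<n. candidate k i j \<in> {0, 1} then printed k m 0 else [0])"
    by blast
  have "correct_answer_22 m n S ys"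
    unfolding k(3) s_def by (rule correct_answer_22_least[OF assms]) (use k(1,2) in \<open>simp_all add: s_def\<close>)
  moreover have "m \<le> m * n" "n \<le> m * n" "1 \<le> m * n"
    using assms by simp_all
  \<comment> \<open>327 is the sum of the coefficients of \<open>time_bound_solver\<close> plus 1 for the final \<open>Halt\<close>.\<close>
  then have "t \<le> 327 * (m * n)"
    using run(2) unfolding time_bound_solver by linarith
  ultimately show thesis
    using that run(1) by blast
qed

text \<open>Every number of the input has length at least 1, and \<open>m \<le> 2 * (m - 1)\<close> for \<open>m \<ge> 2\<close>.\<close>

lemma size_le_input_length:
  assumes "2 \<le> m" "2 \<le> n" "S \<in> carrier_mat (m - 1) (n - 1)"
  shows "m * n \<le> 4 * input_length (encode_instance m n S)"
proof -
  have "m * n \<le> (2 * (m - 1)) * (2 * (n - 1))"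
    using assms(1,2) by (intro mult_mono) auto
  also have "\<dots> = 4 * length (entries S)"
    unfolding entries_eq[OF assms(3)] by (simp add: length_concat o_def sum_list_triv)
  also have "\<dots> \<le> 4 * input_length (encode_instance m n S)"
    using length_le_input_length[of "encode_instance m n S"] by (simp add: encode_instance_def)
  finally show ?thesis .
qed

theorem theorem1:
  shows "(\<exists>(P :: instr list) (p :: nat poly).
            \<forall>(m :: nat) (n :: nat) (S :: int mat).
              2 \<le> m \<longrightarrow> 2 \<le> n \<longrightarrow> S \<in> carrier_mat (m - 1) (n - 1) \<longrightarrow>
              (\<exists>t w ys. run P (encode_instance m n S) t w ys \<and>
                 correct_answer_22 m n S ys \<and>
                 w \<le> poly p (input_length (encode_instance m n S))))
       \<and> (\<exists>(P :: instr list) (C :: nat).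
            \<forall>(m :: nat) (n :: nat) (S :: int mat).
              2 \<le> m \<longrightarrow> 2 \<le> n \<longrightarrow> S \<in> carrier_mat (m - 1) (n - 1) \<longrightarrow>
              (\<exists>t w ys. run P (encode_instance m n S) t w ys \<and>
                 correct_answer_22 m n S ys \<and>
                 t \<le> C * (m * n)))"
proof
  obtain K where K: "\<And>xs t w ys. run (program solver) xs t w ys \<Longrightarrow>
      w \<le> t * (2 * (K + input_length xs + t))"
    using run_cost_le by metis
  \<comment> \<open>1308 is 4 * 327: the factor 327 of the time bound, and the factor 4 from comparing
    \<open>m * n\<close> with the input length.\<close>
  define p :: "nat poly" where "p = [:0, 1308:] * ([:2:] * ([:K:] + [:0, 1:] + [:0, 1308:]))"
  have "\<exists>t w ys. run (program solver) (encode_instance m n S) t w ys \<and> correct_answer_22 m n S ys \<and>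
      w \<le> poly p (input_length (encode_instance m n S))"
    if mnS: "2 \<le> m" "2 \<le> n" "S \<in> carrier_mat (m - 1) (n - 1)" for m n S
  proof -
    let ?L = "input_length (encode_instance m n S)"
    obtain t w ys where *: "run (program solver) (encode_instance m n S) t w ys"
      "correct_answer_22 m n S ys" "t \<le> 327 * (m * n)"
      by (rule run_solver[OF mnS])
    have t: "t \<le> 1308 * ?L"
      using *(3) size_le_input_length[OF mnS] by linarith
    have "w \<le> t * (2 * (K + ?L + t))"
      by (rule K[OF *(1)])
    also have "\<dots> \<le> (1308 * ?L) * (2 * (K + ?L + 1308 * ?L))"
      using t by (intro mult_mono add_mono) auto
    also have "\<dots> = poly p ?L"
      by (simp add: p_def algebra_simps)
    finally show ?thesis
      using *(1,2) by blast
  qed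
  then show "\<exists>(P :: instr list) (p :: nat poly). \<forall>(m :: nat) (n :: nat) (S :: int mat).
      2 \<le> m \<longrightarrow> 2 \<le> n \<longrightarrow> S \<in> carrier_mat (m - 1) (n - 1) \<longrightarrow>
      (\<exists>t w ys. run P (encode_instance m n S) t w ys \<and> correct_answer_22 m n S ys \<and>
        w \<le> poly p (input_length (encode_instance m n S)))"
    by blast
  show "\<exists>(P :: instr list) (C :: nat). \<forall>(m :: nat) (n :: nat) (S :: int mat).
      2 \<le> m \<longrightarrow> 2 \<le> n \<longrightarrow> S \<in> carrier_mat (m - 1) (n - 1) \<longrightarrow>
      (\<exists>t w ys. run P (encode_instance m n S) t w ys \<and> correct_answer_22 m n S ys \<and> t \<le> C * (m * n))"
    by (metis run_solver)
qed

end
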